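(* Let $m$ be a non-zero measure on $(0,\infty)$ with $\inf\mathcal{S}(m)>0$ and $\overline m_0<\infty$. Let $a,b>0$ and $M\in\mathcal{M}$ be the unique triple with $$\int\frac{m(du)}{\lambda+u}=\frac{1}{a\lambda+b+\int\frac{\lambda}{\lambda+u}M(du)},\qquad\lambda>0,$$ and let $n(dy)=dy\int u^2e^{-uy}M(du)$. Then the bilinear form $\mathcal{E}$ of the CBCI-process with quadruplet $(a,b,n,1)$ satisfies $$\mathrm{Sect}(\mathcal{E})^2-1\ge\frac{(\overline m_{-1}\overline m_{-3}-\overline m_{-2}^2)^2}{2\overline m_{-1}\overline m_{-2}^2\overline m_{-3}+4\overline m_{-1}^2\overline m_{-2}^3+12\overline m_{-1}^2\overline m_{-2}\overline m_{-4}-9\overline m_{-1}^2\overline m_{-3}^2-\overline m_{-2}^4}.$$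
   Context: $\mathcal{M}$: measures on $(0,\infty)$ with $\int(1+u)^{-1}m(du)<\infty$; $\overline m_\alpha=\int u^\alpha m(du)$; $\mathcal{S}(m)$ the support of $m$. The CBCI-process with quadruplet $(a,b,n,1)$ is the Markov process on $\mathbb{R}_+$ with generator $Lf(x)=axf''(x)-bxf'(x)+x\int_0^\infty[f(x+y)-f(x)-yf'(x)]n(dy)+f'(x)$ (domain $D(L)$), with unique stationary distribution $\nu$; $\mathcal{E}(f,g)=\int(-Lf)g\,d\nu$; $\mathrm{Sect}(\mathcal{E})$ is the infimum of finite $C$ with $\mathcal{E}(f,g)\le C\mathcal{E}(f,f)^{1/2}\mathcal{E}(g,g)^{1/2}$ for all $f,g\in D(L)$ ($=\infty$ if none). *)

theory Defs
  imports "HOL-Analysis.Analysis" "HOL-Probability.Probability"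
begin

definition on_pos_halfline :: "real measure \<Rightarrow> bool" where
  "on_pos_halfline m \<longleftrightarrow> sets m = sets borel \<and> emeasure m {..0} = 0"

definition calM :: "real measure set" where
  "calM = {M. on_pos_halfline M \<and> (\<integral>\<^sup>+ u. ennreal (1 / (1 + u)) \<partial>M) < \<infinity>}"

definition mbar :: "real measure \<Rightarrow> real \<Rightarrow> real" where
  "mbar m \<alpha> = (\<integral> u. u powr \<alpha> \<partial>m)"

definition msupport :: "real measure \<Rightarrow> real set" where
  "msupport m = {u. \<forall>e>0. emeasure m (ball u e) > 0}"

definition n_of :: "real measure \<Rightarrow> real measure" where
  "n_of M = density lborel
     (\<lambda>y. if y > 0 then \<integral>\<^sup>+ u. ennreal (u\<^sup>2 * exp (- u * y)) \<partial>M else 0)"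

definition cbciL :: "real \<Rightarrow> real \<Rightarrow> real measure \<Rightarrow> (real \<Rightarrow> real) \<Rightarrow> real \<Rightarrow> real" where
  "cbciL a b n f x =
     a * x * deriv (deriv f) x - b * x * deriv f x
     + x * (\<integral> y. f (x + y) - f x - y * deriv f x \<partial>n) + deriv f x"

definition cbci_core :: "(real \<Rightarrow> real) set" where
  "cbci_core = {f. (\<forall>x. f differentiable at x) \<and> (\<forall>x. deriv f differentiable at x)
      \<and> continuous_on UNIV (deriv (deriv f))
      \<and> (\<exists>K. compact K \<and> (\<forall>x. x \<notin> K \<longrightarrow> f x = 0))}"

definition cbci_stationary :: "real \<Rightarrow> real \<Rightarrow> real measure \<Rightarrow> real measure \<Rightarrow> bool" where
  "cbci_stationary a b n \<nu> \<longleftrightarrow> prob_space \<nu> \<and> sets \<nu> = sets borel \<and> emeasure \<nu> {..<0} = 0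
     \<and> (\<forall>f \<in> cbci_core. (\<integral> x. cbciL a b n f x \<partial>\<nu>) = 0)"

definition cbciE :: "real \<Rightarrow> real \<Rightarrow> real measure \<Rightarrow> real measure
     \<Rightarrow> (real \<Rightarrow> real) \<Rightarrow> (real \<Rightarrow> real) \<Rightarrow> real" where
  "cbciE a b n \<nu> f g = (\<integral> x. (- cbciL a b n f x) * g x \<partial>\<nu>)"

text \<open>Sector constant (infinity if no finite constant works).\<close>
definition Sect :: "real \<Rightarrow> real \<Rightarrow> real measure \<Rightarrow> real measure \<Rightarrow> ereal" where
  "Sect a b n \<nu> = Inf (ereal ` {C. \<forall>f \<in> cbci_core. \<forall>g \<in> cbci_core.
      cbciE a b n \<nu> f g \<le> C * sqrt (cbciE a b n \<nu> f f) * sqrt (cbciE a b n \<nu> g g)})"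

end

theory Submission
  imports Defs "HOL-Real_Asymp.Real_Asymp"
begin

text \<open>
  The stationary law \<open>\<nu>\<close> is the generalised gamma convolution with Thorin measure \<open>m\<close>: testing stationarity
  against \<open>exp (- l * x)\<close> gives \<open>- \<phi>' = \<Phi> * \<phi>\<close> for its Laplace transform \<open>\<phi>\<close> and the Stieltjes transform \<open>\<Phi>\<close>
  of \<open>m\<close>. Differentiating three times and letting \<open>l\<close> tend to 0 gives the moments of \<open>\<nu>\<close> up to order 4; its
  cumulants are \<open>fact (k - 1) * mbar m (- k)\<close>. The form therefore extends to the span of \<open>x\<close> and \<open>x\<^sup>2\<close>, where it
  is a \<open>2 \<times> 2\<close> matrix. If \<open>\<Delta>\<close> is the determinant of its symmetric part and \<open>t\<close> the entry of its antisymmetric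
  part, then in coordinates orthonormal for the symmetric part the form is the identity plus \<open>t / sqrt \<Delta>\<close> times
  a rotation by a right angle, so the sector constant is at least \<open>sqrt (1 + t\<^sup>2 / \<Delta>)\<close>.
\<close>

text \<open>All that is known about \<open>\<nu>\<close> is that \<open>L f\<close> has integral
  zero for \<open>f\<close> of class C^2 with compact support; no moment of \<open>\<nu>\<close> is
  assumed finite. Neither exponentials nor polynomials lie in \<open>cbci_core\<close>, so both are
  reached through a cutoff at scale \<open>R\<close> with bounds uniform in \<open>R\<close>.
  Exponentials give access to the moments because their weights are bounded on the half-line: the
  limit in \<open>R\<close> costs nothing, and monotone convergence as \<open>l\<close> decreases to
  0 turns the resulting identities into finiteness of the moments. For quadratics \<open>f\<close>
  and \<open>g\<close> the product of \<open>L f\<close> and \<open>g\<close> grows like the fourth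
  power, which is why order 4 is the target. The data \<open>a\<close>, \<open>b\<close>,
  \<open>M\<close> enter the matrix of the form only through \<open>b\<close> and
  \<open>2 * a + n2\<close>, where \<open>n2\<close> is the second moment of the jump measure. Both
  are read off the first-order expansion at 0 of the reciprocal of the Stieltjes transform of
  \<open>m\<close>: its value is \<open>b\<close>, its slope is \<open>a\<close> plus the integral
  of \<open>1 / u\<close> against \<open>M\<close>. Hence \<open>a\<close> cancels and only negative
  moments of \<open>m\<close> survive.\<close>

section \<open>Preliminaries from measure theory and calculus\<close>

text \<open>Multiplying the finite measure \<open>density M g\<close> by the reciprocal of
  \<open>g\<close> recovers \<open>M\<close>. Used for \<open>M\<close> with weight
  \<open>1 / (1 + u)\<close>, to have Tonelli, and for the jump measure with weight
  \<open>y\<^sup>2\<close>, to have measurable parameter integrals.\<close>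

lemma sigma_finite_of_nn_integral_pos:
  assumes g: "g \<in> borel_measurable M" and fin: "(\<integral>\<^sup>+ x. g x \<partial>M) < \<infinity>"
    and pos: "AE x in M. 0 < g x"
  shows "sigma_finite_measure M"
proof -
  let ?D = "density M g"
  have "finite_measure ?D"
    using fin g by (intro finite_measureI) (simp add: emeasure_density cong: nn_integral_cong)
  then interpret D: finite_measure ?D .
  have "AE x in M. g x \<noteq> \<infinity>"
    using fin g by (intro nn_integral_PInf_AE) auto
  then have one: "AE x in M. g x * inverse (g x) = 1"
    using pos by eventually_elim (simp add: ennreal_divide_self less_top flip: divide_ennreal_def)
  have "density ?D (\<lambda>x. inverse (g x)) = density M (\<lambda>x. g x * inverse (g x))"
    using g by (intro density_density_eq) auto
  also have "\<dots> = density M (\<lambda>_. 1)"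
    using g one by (intro density_cong) auto
  also have "\<dots> = M"
    by (rule density_1)
  finally have M: "density ?D (\<lambda>x. inverse (g x)) = M" .
  have "AE x in ?D. inverse (g x) \<noteq> \<infinity>"
    using pos by (subst AE_density[OF g]) (auto elim!: eventually_mono)
  then have "sigma_finite_measure (density ?D (\<lambda>x. inverse (g x)))"
    using g by (subst D.sigma_finite_iff_density_finite) auto
  then show ?thesis
    by (simp add: M)
qed

text \<open>On the ball of radius \<open>e\<close> the mean value inequality bounds the difference
  quotients by \<open>w\<close>, so dominated convergence applies along every sequence tending to
  0.\<close>

lemma has_real_derivative_integral:
  fixes F F' :: "real \<Rightarrow> 'a \<Rightarrow> real"
  assumes e: "0 < e"
    and int: "\<And>s. \<bar>s - t\<bar> < e \<Longrightarrow> integrable M (F s)"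
    and F': "AE x in M. \<forall>s. \<bar>s - t\<bar> < e \<longrightarrow>
      ((\<lambda>s. F s x) has_real_derivative F' s x) (at s) \<and> \<bar>F' s x\<bar> \<le> w x"
    and meas: "F' t \<in> borel_measurable M" and w: "integrable M w"
  shows "((\<lambda>s. \<integral>x. F s x \<partial>M) has_real_derivative (\<integral>x. F' t x \<partial>M)) (at t)"
  unfolding DERIV_def tendsto_at_iff_sequentially
proof (intro allI impI)
  fix X :: "nat \<Rightarrow> real"
  assume X0: "\<forall>i. X i \<in> UNIV - {0}" and X: "X \<longlonglongrightarrow> 0"
  obtain N where N: "\<And>i. i \<ge> N \<Longrightarrow> \<bar>X i\<bar> < e"
    using LIMSEQ_D[OF X e] by auto
  \<comment> \<open>Dropping the first \<open>N\<close> terms keeps every \<open>t + Y i\<close> in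
    the ball where the bound holds.\<close>
  define Y where "Y i = X (i + N)" for i
  have Y1: "Y \<longlonglongrightarrow> 0"
    unfolding Y_def[abs_def] by (rule LIMSEQ_ignore_initial_segment[OF X])
  have Y2: "Y i \<noteq> 0" and Y3: "\<bar>Y i\<bar> < e" for i
    using X0 N[of "i + N"] by (auto simp: Y_def)
  note Y = Y1 Y2 Y3
  have intY: "integrable M (F (t + Y i))" for i
    using Y(3) by (intro int) auto
  have intt: "integrable M (F t)"
    using e by (intro int) auto
  have "(\<lambda>i. \<integral>x. (F (t + Y i) x - F t x) / Y i \<partial>M) \<longlonglongrightarrow> (\<integral>x. F' t x \<partial>M)"
  proof (rule integral_dominated_convergence[where w = w])
    show "AE x in M. (\<lambda>i. (F (t + Y i) x - F t x) / Y i) \<longlonglongrightarrow> F' t x"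
      using F'
    proof eventually_elim
      case (elim x)
      then have "((\<lambda>h. (F (t + h) x - F t x) / h) \<longlongrightarrow> F' t x) (at 0)"
        using e by (simp add: DERIV_def)
      moreover have "filterlim Y (at 0) sequentially"
        using Y(1,2) by (simp add: filterlim_at)
      ultimately show ?case
        by (rule filterlim_compose)
    qed
    show "AE x in M. norm ((F (t + Y i) x - F t x) / Y i) \<le> w x" for i
      using F'
    proof eventually_elim
      case (elim x)
      then have d: "((\<lambda>s. F s x) has_real_derivative F' s x) (at s within ball t e)"
        and b: "norm (F' s x) \<le> w x" if "s \<in> ball t e" for s
        using that by (auto simp: dist_commute dist_real_def[of s t] intro: has_field_derivative_at_within)
      have "t \<in> ball t e" "t + Y i \<in> ball t e"
        using e Y(3)[of i] by (auto simp: dist_real_def)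
      then have "norm (F (t + Y i) x - F t x) \<le> w x * norm (t + Y i - t)"
        by (intro field_differentiable_bound[OF convex_ball d b])
      then show ?case
        using Y(2)[of i] by (simp add: divide_le_eq)
    qed
  qed (use intY intt meas w in auto)
  then have "(\<lambda>i. ((\<integral>x. F (t + Y i) x \<partial>M) - (\<integral>x. F t x \<partial>M)) / Y i) \<longlonglongrightarrow> (\<integral>x. F' t x \<partial>M)"
    using intY intt by simp
  then show "((\<lambda>h. ((\<integral>x. F (t + h) x \<partial>M) - (\<integral>x. F t x \<partial>M)) / h) \<circ> X) \<longlonglongrightarrow> (\<integral>x. F' t x \<partial>M)"
    unfolding Y_def comp_def by (rule LIMSEQ_offset)
qed

text \<open>Jumps only go upward, so the second derivative matters only to the right of
  \<open>x\<close>; tempered functions are controlled only on the nonnegative half-line.\<close>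

lemma Taylor2_bound:
  fixes f f1 f2 :: "real \<Rightarrow> real"
  assumes "0 \<le> y" and "\<And>z. x \<le> z \<Longrightarrow> (f has_real_derivative f1 z) (at z)"
    and "\<And>z. x \<le> z \<Longrightarrow> (f1 has_real_derivative f2 z) (at z)"
    and bound: "\<And>z. x \<le> z \<Longrightarrow> \<bar>f2 z\<bar> \<le> D"
  shows "\<bar>f (x + y) - f x - y * f1 x\<bar> \<le> D / 2 * y\<^sup>2"
proof (cases "y = 0")
  case False
  define d where "d m = (if m = 0 then f else if m = 1 then f1 else f2)" for m :: nat
  have "\<exists>t>x. t < x + y \<and> f (x + y) = (\<Sum>m<2. d m x / fact m * (x + y - x) ^ m) + d 2 t / fact 2 * (x + y - x) ^ 2"
    using assms False by (intro Taylor_up[of 2 d f x "x + y" x]) (auto simp: d_def less_2_cases_iff)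
  then obtain t where t: "t > x" "f (x + y) = f x + f1 x * y + f2 t / 2 * y\<^sup>2"
    by (auto simp: d_def numeral_2_eq_2)
  then have "\<bar>f (x + y) - f x - y * f1 x\<bar> = \<bar>f2 t\<bar> / 2 * y\<^sup>2"
    by (simp add: abs_mult)
  also have "\<dots> \<le> D / 2 * y\<^sup>2"
    using bound[of t] t(1) by (intro mult_right_mono divide_right_mono) auto
  finally show ?thesis .
qed simp

text \<open>The corner of the positive part disappears from the second power on: at 0 the difference
  quotient is at most \<open>\<bar>h\<bar> ^ Suc k\<close>. Exponents 3 and 2 serve the two
  derivatives of the cutoff.\<close>

lemma DERIV_max0_power:
  "((\<lambda>t::real. max 0 t ^ Suc (Suc k)) has_real_derivative real (k + 2) * max 0 t ^ Suc k) (at t)"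
proof -
  consider "t > 0" | "t < 0" | "t = 0"
    by linarith
  then show ?thesis
  proof cases
    case 1
    have "((\<lambda>t::real. t ^ Suc (Suc k)) has_real_derivative real (k + 2) * max 0 t ^ Suc k) (at t)"
      by (rule DERIV_cong[OF DERIV_pow]) (use 1 in simp)
    then show ?thesis
      by (rule has_field_derivative_transform_within_open[where S = "{0<..}"]) (use 1 in auto)
  next
    case 2
    have "((\<lambda>t::real. 0) has_real_derivative real (k + 2) * max 0 t ^ Suc k) (at t)"
      using 2 by (auto simp: max_def)
    then show ?thesis
      by (rule has_field_derivative_transform_within_open[where S = "{..<0}"]) (use 2 in auto)
  next
    case 3
    have "((\<lambda>h::real. max 0 h ^ Suc (Suc k) / h) \<longlongrightarrow> 0) (at 0)"
    proof (rule Lim_null_comparison)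
      show "\<forall>\<^sub>F h in at 0. norm (max 0 h ^ Suc (Suc k) / h) \<le> \<bar>h\<bar> ^ Suc k"
      proof (intro always_eventually allI)
        show "norm (max 0 h ^ Suc (Suc k) / h) \<le> \<bar>h\<bar> ^ Suc k" for h :: real
          by (cases "0 < h") (auto simp: max_def not_less mult_nonpos_nonneg)
      qed
      show "((\<lambda>h::real. \<bar>h\<bar> ^ Suc k) \<longlongrightarrow> 0) (at 0)"
        by (auto intro!: tendsto_eq_intros)
    qed
    then show ?thesis
      using 3 by (simp add: DERIV_def)
  qed
qed

section \<open>A cutoff of class C^2\<close>

text \<open>The cube is the least power for which the second derivative is continuous at the ends of
  the support, as \<open>cbci_core\<close> demands.\<close>

definition cutoff :: "real \<Rightarrow> real" where
  "cutoff t = max 0 (1 - t\<^sup>2) ^ 3"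

definition cutoff1 :: "real \<Rightarrow> real" where
  "cutoff1 t = - (6 * t * max 0 (1 - t\<^sup>2) ^ 2)"

definition cutoff2 :: "real \<Rightarrow> real" where
  "cutoff2 t = 24 * t\<^sup>2 * max 0 (1 - t\<^sup>2) - 6 * max 0 (1 - t\<^sup>2) ^ 2"

lemma DERIV_cutoff: "(cutoff has_real_derivative cutoff1 t) (at t)"
proof -
  have "((\<lambda>t::real. max 0 (1 - t\<^sup>2) ^ Suc (Suc 1)) has_real_derivative real (1 + 2) * max 0 (1 - t\<^sup>2) ^ Suc 1 * (- (2 * t))) (at t)"
    by (rule DERIV_chain2[OF DERIV_max0_power]) (auto intro!: derivative_eq_intros)
  then show ?thesis
    by (simp add: cutoff_def[abs_def] cutoff1_def numeral_eq_Suc mult_ac)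
qed

lemma DERIV_cutoff1: "(cutoff1 has_real_derivative cutoff2 t) (at t)"
proof -
  have *: "((\<lambda>t::real. max 0 (1 - t\<^sup>2) ^ Suc (Suc 0)) has_real_derivative real (0 + 2) * max 0 (1 - t\<^sup>2) ^ Suc 0 * (- (2 * t))) (at t)"
    by (rule DERIV_chain2[OF DERIV_max0_power]) (auto intro!: derivative_eq_intros)
  have *: "((\<lambda>t::real. max 0 (1 - t\<^sup>2) ^ 2) has_real_derivative - (4 * t * max 0 (1 - t\<^sup>2))) (at t)"
    by (rule DERIV_cong[OF *[folded numeral_2_eq_2]]) auto
  show ?thesis
    unfolding cutoff1_def[abs_def] cutoff2_def
    by (rule derivative_eq_intros * refl)+ (simp add: power2_eq_square)
qed

lemma cutoff_eq_0: "1 \<le> \<bar>t\<bar> \<Longrightarrow> cutoff t = 0" "1 \<le> \<bar>t\<bar> \<Longrightarrow> cutoff1 t = 0" "1 \<le> \<bar>t\<bar> \<Longrightarrow> cutoff2 t = 0"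
  using abs_le_square_iff[of 1 t] by (auto simp: cutoff_def cutoff1_def cutoff2_def max_def)

lemma cutoff_bound: "\<bar>cutoff t\<bar> \<le> 1" "\<bar>cutoff1 t\<bar> \<le> 6" "\<bar>cutoff2 t\<bar> \<le> 24"
proof -
  let ?p = "max 0 (1 - t\<^sup>2)"
  have p: "0 \<le> ?p" "?p \<le> 1" "?p\<^sup>2 \<le> 1" "?p ^ 3 \<le> 1"
    by (auto intro!: power_le_one)
  show "\<bar>cutoff t\<bar> \<le> 1"
    using p by (simp add: cutoff_def)
  have "\<bar>cutoff1 t\<bar> \<le> 6 \<and> \<bar>cutoff2 t\<bar> \<le> 24" if "\<bar>t\<bar> < 1"
  proof -
    have t: "t\<^sup>2 \<le> 1"
      using that abs_square_le_1[of t] by simp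
    have "\<bar>t\<bar> * ?p\<^sup>2 \<le> 1 * 1"
      using p that by (intro mult_mono) auto
    moreover have "t\<^sup>2 * ?p \<le> 1 * 1"
      using p t by (intro mult_mono) auto
    moreover have "0 \<le> t\<^sup>2 * ?p" "0 \<le> ?p\<^sup>2"
      by auto
    \<comment> \<open>The two terms lie in \<open>[0, 24]\<close> and \<open>[0, 6]\<close>, so
      their difference has absolute value at most 24.\<close>
    ultimately have "\<bar>24 * (t\<^sup>2 * ?p) - 6 * ?p\<^sup>2\<bar> \<le> 24" "6 * (\<bar>t\<bar> * ?p\<^sup>2) \<le> 6"
      using p(3) by linarith+
    then show ?thesis
      by (simp add: cutoff1_def cutoff2_def abs_mult mult.assoc)
  qed
  moreover have "\<bar>cutoff1 t\<bar> \<le> 6 \<and> \<bar>cutoff2 t\<bar> \<le> 24" if "1 \<le> \<bar>t\<bar>"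
    using cutoff_eq_0(2,3)[OF that] by simp
  ultimately show "\<bar>cutoff1 t\<bar> \<le> 6" "\<bar>cutoff2 t\<bar> \<le> 24"
    by (meson not_le)+
qed

lemma continuous_on_cutoff2: "continuous_on A cutoff2"
  unfolding cutoff2_def[abs_def] by (intro continuous_on_diff continuous_on_mult continuous_on_max continuous_on_power continuous_on_const continuous_on_id)

subsection \<open>Integration against \<open>n(dy)\<close>\<close>

lemma sets_n_of [simp, measurable_cong]: "sets (n_of M) = sets borel"
  by (simp add: n_of_def)

text \<open>The weight \<open>1 / (1 + u)\<close> is positive and integrable; it yields
  sigma-finiteness, and times \<open>max 1 (1 / l)\<close> it dominates
  \<open>1 / (l + u)\<close>.\<close>

lemma calM_D:
  assumes "M \<in> calM"
  shows "sets M = sets borel" and "AE u in M. 0 < u" and "sigma_finite_measure M"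
    and "0 < l \<Longrightarrow> integrable M (\<lambda>u. 1 / (l + u))"
proof -
  show sets: "sets M = sets borel"
    using assms by (simp add: calM_def on_pos_halfline_def)
  note [measurable_cong] = sets
  have null: "emeasure M {..0} = 0"
    using assms by (simp add: calM_def on_pos_halfline_def)
  show pos: "AE u in M. 0 < u"
    by (rule AE_I[OF _ null]) (auto simp: sets)
  have fin: "(\<integral>\<^sup>+ u. ennreal (1 / (1 + u)) \<partial>M) < \<infinity>"
    using assms by (simp add: calM_def)
  show "sigma_finite_measure M"
    by (rule sigma_finite_of_nn_integral_pos[OF _ fin]) (use pos in \<open>auto elim!: eventually_mono\<close>)
  have int1: "integrable M (\<lambda>u. 1 / (1 + u))"
    using fin pos by (intro integrableI_nonneg) (auto elim!: eventually_mono)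
  assume l: "0 < l"
  show "integrable M (\<lambda>u. 1 / (l + u))"
  proof (rule Bochner_Integration.integrable_bound)
    show "integrable M (\<lambda>u. max 1 (1 / l) * (1 / (1 + u)))"
      using int1 by (rule integrable_mult_right)
    show "AE u in M. norm (1 / (l + u)) \<le> norm (max 1 (1 / l) * (1 / (1 + u)))"
      using pos
    proof eventually_elim
      case (elim u)
      have "1 \<le> max 1 (1 / l) * l"
        using l by (simp add: max_def field_simps)
      moreover have "u \<le> max 1 (1 / l) * u"
        using elim by (simp add: max_def)
      ultimately have "1 + u \<le> max 1 (1 / l) * (l + u)"
        by (simp add: distrib_left)
      then show ?case
        using l elim by (simp add: field_simps)
    qed
  qed simp
qed

text \<open>Tonelli reduces integrals against the jump measure to integrals against single
  exponential densities. The half-line is closed at 0, unlike in \<open>n_of\<close>, to suit the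
  fundamental theorem of calculus; the point 0 is a null set.\<close>

lemma nn_integral_n_of:
  assumes M: "M \<in> calM" and [measurable]: "g \<in> borel_measurable borel"
    and nonneg: "\<And>y. 0 < y \<Longrightarrow> 0 \<le> g y"
  shows "(\<integral>\<^sup>+ y. ennreal (g y) \<partial>n_of M) =
    (\<integral>\<^sup>+ u. \<integral>\<^sup>+ y. ennreal (g y * (u\<^sup>2 * exp (- u * y))) * indicator {0..} y \<partial>lborel \<partial>M)"
proof -
  note [measurable_cong] = calM_D(1)[OF M]
  interpret M: sigma_finite_measure M
    by (rule calM_D(3)[OF M])
  interpret pair_sigma_finite lborel M
    by standard
  have [measurable]: "(\<lambda>y. \<integral>\<^sup>+ u. ennreal (u\<^sup>2 * exp (- u * y)) \<partial>M) \<in> borel_measurable borel"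
    by measurable
  have "(\<integral>\<^sup>+ y. ennreal (g y) \<partial>n_of M) =
      (\<integral>\<^sup>+ y. (if y > 0 then \<integral>\<^sup>+ u. ennreal (u\<^sup>2 * exp (- u * y)) \<partial>M else 0) * ennreal (g y) \<partial>lborel)"
    unfolding n_of_def by (subst nn_integral_density) auto
  also have "\<dots> = (\<integral>\<^sup>+ y. \<integral>\<^sup>+ u. ennreal (g y * (u\<^sup>2 * exp (- u * y))) * indicator {0..} y \<partial>M \<partial>lborel)"
  proof (rule nn_integral_cong_AE)
    show "AE y in lborel. (if y > 0 then \<integral>\<^sup>+ u. ennreal (u\<^sup>2 * exp (- u * y)) \<partial>M else 0) * ennreal (g y) =
        (\<integral>\<^sup>+ u. ennreal (g y * (u\<^sup>2 * exp (- u * y))) * indicator {0..} y \<partial>M)"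
      using AE_lborel_singleton[of "0::real"]
    proof eventually_elim
      case (elim y)
      show ?case
      proof (cases "0 < y")
        case True
        then have "(\<integral>\<^sup>+ u. ennreal (g y * (u\<^sup>2 * exp (- u * y))) * indicator {0..} y \<partial>M)
          = (\<integral>\<^sup>+ u. ennreal (u\<^sup>2 * exp (- u * y)) * ennreal (g y) \<partial>M)"
          using nonneg[OF True] by (intro nn_integral_cong) (simp add: ennreal_mult' mult.commute)
        also have "\<dots> = (\<integral>\<^sup>+ u. ennreal (u\<^sup>2 * exp (- u * y)) \<partial>M) * ennreal (g y)"
          by (rule nn_integral_multc) simp
        finally show ?thesis
          using True by simp
      qed (use elim in auto)
    qed
  qed
  also have "\<dots> = (\<integral>\<^sup>+ u. \<integral>\<^sup>+ y. ennreal (g y * (u\<^sup>2 * exp (- u * y))) * indicator {0..} y \<partial>lborel \<partial>M)"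
    by (rule Fubini'[symmetric]) measurable
  finally show ?thesis .
qed

lemma AE_n_of_pos: "AE y in n_of M. 0 < y" if M: "M \<in> calM"
proof -
  note [measurable_cong] = calM_D(1)[OF M]
  interpret M: sigma_finite_measure M
    by (rule calM_D(3)[OF M])
  show ?thesis
    unfolding n_of_def by (subst AE_density) auto
qed

lemma nn_integral_square_exp:
  assumes u: "(0::real) < u"
  shows "(\<integral>\<^sup>+ y. ennreal (y\<^sup>2 * (u\<^sup>2 * exp (- u * y))) * indicator {0..} y \<partial>lborel) = ennreal (2 / u)"
proof -
  let ?F = "\<lambda>y. - ((u * y\<^sup>2 + 2 * y + 2 / u) * exp (- u * y))"
  have "(\<integral>\<^sup>+ y. ennreal (y\<^sup>2 * (u\<^sup>2 * exp (- u * y))) * indicator {0..} y \<partial>lborel) = ennreal (0 - ?F 0)"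
  proof (rule nn_integral_FTC_atLeast)
    show "(?F has_real_derivative y\<^sup>2 * (u\<^sup>2 * exp (- u * y))) (at y)" for y
      using u by (auto intro!: derivative_eq_intros simp: field_simps power2_eq_square)
    show "(?F \<longlongrightarrow> 0) at_top"
      using u by real_asymp
  qed auto
  then show ?thesis
    by simp
qed

text \<open>The three terms integrate to \<open>u\<^sup>2 / (l + u) - u + l\<close>. Integrated
  against \<open>M\<close>, the value is \<open>l\<close> times the \<open>M\<close>-term of the
  Stieltjes relation, which links the jump measure to \<open>m\<close>.\<close>

lemma nn_integral_compensated_exp:
  assumes u: "(0::real) < u" and l: "0 < l"
  shows "(\<integral>\<^sup>+ y. ennreal ((exp (- l * y) - 1 + l * y) * (u\<^sup>2 * exp (- u * y))) * indicator {0..} y \<partial>lborel)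
    = ennreal (l\<^sup>2 / (l + u))"
proof -
  let ?F = "\<lambda>y. - (u\<^sup>2 / (l + u) * exp (- (l + u) * y)) + u * exp (- u * y) - l * (u * y + 1) * exp (- u * y)"
  have "(\<integral>\<^sup>+ y. ennreal ((exp (- l * y) - 1 + l * y) * (u\<^sup>2 * exp (- u * y))) * indicator {0..} y \<partial>lborel)
      = ennreal (0 - ?F 0)"
  proof (rule nn_integral_FTC_atLeast)
    show "(?F has_real_derivative (exp (- l * y) - 1 + l * y) * (u\<^sup>2 * exp (- u * y))) (at y)" for y
    proof -
      have lu: "l + u \<noteq> 0"
        using u l by simp
      then have q: "u\<^sup>2 / (l + u) * (l + u) = u\<^sup>2"
        by simp
      have e: "exp (- (l + u) * y) = exp (- l * y) * exp (- u * y)"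
        by (simp add: algebra_simps flip: exp_add)
      have "(?F has_real_derivative (u\<^sup>2 / (l + u) * (l + u)) * exp (- (l + u) * y) - u\<^sup>2 * exp (- u * y)
          - l * u * exp (- u * y) + l * (u * y + 1) * u * exp (- u * y)) (at y)"
        by (rule derivative_eq_intros refl)+ (simp add: algebra_simps add_divide_distrib power2_eq_square)
      then show ?thesis
        unfolding q by (rule DERIV_cong) (unfold e, simp add: algebra_simps power2_eq_square)
    qed
    have "((\<lambda>y. exp (- c * y)) \<longlongrightarrow> 0) at_top" if "0 < c" for c :: real
      using that by real_asymp
    then have "((\<lambda>y. u\<^sup>2 / (l + u) * exp (- (l + u) * y)) \<longlongrightarrow> 0) at_top"
      by (rule tendsto_mult_right_zero) (use u l in simp)
    moreover have "((\<lambda>y. u * exp (- u * y) - l * (u * y + 1) * exp (- u * y)) \<longlongrightarrow> 0) at_top"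
      using u l by real_asymp
    ultimately have "((\<lambda>y. u * exp (- u * y) - l * (u * y + 1) * exp (- u * y) - u\<^sup>2 / (l + u) * exp (- (l + u) * y)) \<longlongrightarrow> 0 - 0) at_top"
      by (intro tendsto_diff)
    also have "(\<lambda>y. u * exp (- u * y) - l * (u * y + 1) * exp (- u * y) - u\<^sup>2 / (l + u) * exp (- (l + u) * y)) = ?F"
      by (rule ext) linarith
    finally show "(?F \<longlongrightarrow> 0) at_top"
      by simp
    show "0 \<le> (exp (- l * y) - 1 + l * y) * (u\<^sup>2 * exp (- u * y))" for y
      using exp_ge_add_one_self[of "- l * y"] by (intro mult_nonneg_nonneg) auto
  qed auto
  also have "0 - ?F 0 = l\<^sup>2 / (l + u)"
    using u l by (simp add: field_simps power2_eq_square)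
  finally show ?thesis .
qed

subsection \<open>Consequences of the Stieltjes relation\<close>

locale cbci_triple =
  fixes m M :: "real measure" and a b :: real
  assumes m_pos: "on_pos_halfline m"
    and m_nonzero: "emeasure m UNIV \<noteq> 0"
    and m_supp: "Inf (msupport m) > 0"
    and m_finite: "emeasure m UNIV < \<infinity>"
    and a_pos: "a > 0" and b_pos: "b > 0"
    and M_in: "M \<in> calM"
    and triple: "\<And>l. l > 0 \<Longrightarrow>
        (\<integral> u. 1 / (l + u) \<partial>m) = 1 / (a * l + b + (\<integral> u. l / (l + u) \<partial>M))"
begin

lemma sets_m [measurable_cong, simp]: "sets m = sets borel"
  using m_pos by (simp add: on_pos_halfline_def)

lemma space_m [simp]: "space m = UNIV"
  using sets_eq_imp_space_eq[OF sets_m] by simp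

lemma finite_measure_m: "finite_measure m"
  by (rule finite_measureI) (use m_finite in auto)

sublocale m: finite_measure m
  by (rule finite_measure_m)

definition u0 :: real where
  "u0 = Inf (msupport m)"

lemma u0_pos: "0 < u0"
  using m_supp by (simp add: u0_def)

text \<open>By Lindelof the union of all open null sets is a countable union, hence null, and it
  contains every point below the infimum of the support.\<close>

lemma AE_u0: "AE u in m. u0 \<le> u"
proof -
  \<comment> \<open>A real \<open>Inf\<close> is a lower bound only for sets bounded below, so
    negative points have to be excluded from the support beforehand.\<close>
  have "u \<notin> msupport m" if "u < 0" for u
  proof -
    have "emeasure m (ball u (- u)) \<le> emeasure m {..0}"
      by (rule emeasure_mono) (auto simp: dist_real_def)
    then show ?thesis
      using m_pos that by (auto simp: msupport_def on_pos_halfline_def intro!: exI[of _ "- u"])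
  qed
  then have bdd: "bdd_below (msupport m)"
    by (meson bdd_belowI not_le)
  define F where "F = {B. open B \<and> emeasure m B = 0}"
  obtain F' where F': "F' \<subseteq> F" "countable F'" "\<Union>F' = \<Union>F"
    by (rule Lindelof[of F]) (auto simp: F_def)
  have "\<Union>F' \<in> null_sets m"
    using F'(1,2) by (intro null_sets_UN'[of F' "\<lambda>x. x", simplified])
      (auto simp: F_def null_sets_def)
  then have null: "\<Union>F \<in> null_sets m"
    by (simp add: F')
  have "u \<in> \<Union>F" if "u < u0" for u
  proof -
    have "u \<notin> msupport m"
      using cInf_lower[OF _ bdd, of u] that by (auto simp: u0_def)
    then obtain e where "e > 0" "emeasure m (ball u e) = 0"
      by (auto simp: msupport_def)
    then show ?thesis
      by (intro UnionI[of "ball u e"]) (auto simp: F_def)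
  qed
  then show ?thesis
    by (intro AE_I'[OF null]) (auto simp: not_le)
qed

section \<open>Negative moments of \<open>m\<close>\<close>

text \<open>Up to the factor \<open>(- 1) ^ (k - 1) * fact (k - 1)\<close>, for \<open>k\<close> at
  least 1, this is the derivative of order \<open>k - 1\<close> of the Stieltjes transform of
  \<open>m\<close>; at \<open>l = 0\<close> it is the moment of order \<open>- k\<close>.\<close>

definition St :: "nat \<Rightarrow> real \<Rightarrow> real" where
  "St k l = (\<integral> u. 1 / (l + u) ^ k \<partial>m)"

text \<open>The gap \<open>u0\<close> below the support gives one constant for all
  \<open>l \<ge> 0\<close>; it is the majorant both for differentiating in \<open>l\<close> and for
  letting \<open>l\<close> tend to 0.\<close>

lemma St_bound: "u0 \<le> u \<Longrightarrow> 0 \<le> l \<Longrightarrow> \<bar>1 / (l + u) ^ k\<bar> \<le> 1 / u0 ^ k"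
  using u0_pos by (auto intro!: divide_left_mono power_mono)

lemma integrable_St: "0 \<le> l \<Longrightarrow> integrable m (\<lambda>u. 1 / (l + u) ^ k)"
  using AE_u0 by (intro m.integrable_const_bound[of _ "1 / u0 ^ k"]) (auto elim!: eventually_mono simp del: abs_divide intro!: St_bound)

lemma St_DERIV:
  assumes l: "0 < l"
  shows "(St k has_real_derivative - (real k * St (Suc k) l)) (at l)"
proof -
  \<comment> \<open>\<open>k = 0\<close> is treated apart because the exponent
    \<open>k - Suc 0\<close> is then truncated.\<close>
  have aux: "- (1 / x ^ k * (real k * x ^ (k - Suc 0)) * (1 / x ^ k)) = - real k * (1 / x ^ Suc k)" if "0 < x" for x :: real
    using that by (cases k) (simp_all add: field_simps)
  have "(St k has_real_derivative (\<integral>u. - real k * (1 / (l + u) ^ Suc k) \<partial>m)) (at l)"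
    unfolding St_def[abs_def]
  proof (rule has_real_derivative_integral[OF l, where w = "\<lambda>_. real k * (1 / u0 ^ Suc k)"])
    show "AE u in m. \<forall>s. \<bar>s - l\<bar> < l \<longrightarrow>
       ((\<lambda>s. 1 / (s + u) ^ k) has_real_derivative - real k * (1 / (s + u) ^ Suc k)) (at s) \<and>
       \<bar>- real k * (1 / (s + u) ^ Suc k)\<bar> \<le> real k * (1 / u0 ^ Suc k)"
      using AE_u0
    proof eventually_elim
      case (elim u)
      show ?case
      proof (intro allI impI conjI)
        fix s assume s: "\<bar>s - l\<bar> < l"
        then have su: "s + u > 0" "0 \<le> s"
          using u0_pos elim by auto
        have "((\<lambda>s. inverse ((s + u) ^ k)) has_real_derivative - (inverse ((s + u) ^ k) * (real k * (s + u) ^ (k - Suc 0)) * inverse ((s + u) ^ k))) (at s)"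
          using su by (auto intro!: derivative_eq_intros)
        then show "((\<lambda>s. 1 / (s + u) ^ k) has_real_derivative - real k * (1 / (s + u) ^ Suc k)) (at s)"
          unfolding inverse_eq_divide by (rule DERIV_cong) (use aux[OF su(1)] in simp)
        show "\<bar>- real k * (1 / (s + u) ^ Suc k)\<bar> \<le> real k * (1 / u0 ^ Suc k)"
          using St_bound[OF elim su(2), of "Suc k"] unfolding abs_mult by (intro mult_mono) auto
      qed
    qed
  qed (use integrable_St in auto)
  then show ?thesis
    unfolding integral_mult_right_zero by (simp add: St_def)
qed

lemma St_tendsto:
  assumes X: "X \<longlonglongrightarrow> 0" and X0: "\<And>i. 0 \<le> X i"
  shows "(\<lambda>i. St k (X i)) \<longlonglongrightarrow> St k 0"
  unfolding St_def
proof (rule integral_dominated_convergence[where w = "\<lambda>_. 1 / u0 ^ k"])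
  show "AE u in m. (\<lambda>i. 1 / (X i + u) ^ k) \<longlonglongrightarrow> 1 / (0 + u) ^ k"
    using AE_u0 by eventually_elim (use u0_pos in \<open>intro tendsto_intros X; auto\<close>)
  show "AE u in m. norm (1 / (X i + u) ^ k) \<le> 1 / u0 ^ k" for i
    using AE_u0 by eventually_elim (use St_bound X0 in simp)
qed auto

lemma St_pos: "0 \<le> l \<Longrightarrow> 0 < St k l"
proof -
  assume l: "0 \<le> l"
  have pos: "AE u in m. 0 < 1 / (l + u) ^ k"
    using AE_u0 by eventually_elim (use u0_pos l in auto)
  have "St k l \<noteq> 0"
  proof
    assume "St k l = 0"
    then have "AE u in m. 1 / (l + u) ^ k = 0"
      using pos integrable_St[OF l, of k] unfolding St_def
      by (subst (asm) integral_nonneg_eq_0_iff_AE) (auto elim!: eventually_mono)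
    with pos have "AE u in m. False"
      by eventually_elim simp
    then show False
      using m_nonzero ae_filter_eq_bot_iff[of m] by (simp add: trivial_limit_def)
  qed
  moreover have "0 \<le> St k l"
    unfolding St_def using pos by (intro integral_nonneg_AE) (auto elim!: eventually_mono)
  ultimately show ?thesis
    by simp
qed

lemma mbar_eq_St: "mbar m (- real k) = St k 0"
  unfolding mbar_def St_def
proof (rule integral_cong_AE)
  show "AE u in m. u powr - real k = 1 / (0 + u) ^ k"
    using AE_u0 by eventually_elim (use u0_pos in \<open>simp add: powr_minus powr_realpow inverse_eq_divide\<close>)
qed auto

text \<open>The nonnegative integrand is \<open>(q - p / u)\<^sup>2 / u ^ k\<close>, and its
  integral equals \<open>p * (p * r - q\<^sup>2)\<close>.\<close>

lemma St_cauchy_schwarz: "(St (Suc k) 0)\<^sup>2 \<le> St k 0 * St (Suc (Suc k)) 0"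
proof -
  define e where "e j u = 1 / (0 + u) ^ j" for j and u :: real
  have e: "integrable m (e j)" "integral\<^sup>L m (e j) = St j 0" for j
    using integrable_St[of 0 j] by (simp_all add: St_def e_def[abs_def])
  define p q r where "p = St k 0" and "q = St (Suc k) 0" and "r = St (Suc (Suc k)) 0"
  have "0 \<le> (\<integral>u. q\<^sup>2 * e k u - 2 * p * q * e (Suc k) u + p\<^sup>2 * e (Suc (Suc k)) u \<partial>m)"
  proof (rule integral_nonneg_AE)
    show "AE u in m. 0 \<le> q\<^sup>2 * e k u - 2 * p * q * e (Suc k) u + p\<^sup>2 * e (Suc (Suc k)) u"
      using AE_u0
    proof eventually_elim
      case (elim u)
      then have u: "0 < u"
        using u0_pos by simp
      then have "q\<^sup>2 * e k u - 2 * p * q * e (Suc k) u + p\<^sup>2 * e (Suc (Suc k)) u = (q - p / u)\<^sup>2 / u ^ k"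
        by (simp add: e_def field_simps power2_eq_square)
      then show ?case
        using u by simp
    qed
  qed
  also have "\<dots> = q\<^sup>2 * p - 2 * p * q * q + p\<^sup>2 * r"
    by (simp add: e p_def q_def r_def)
  also have "\<dots> = p * (p * r - q\<^sup>2)"
    by (simp add: power2_eq_square algebra_simps)
  finally show ?thesis
    using St_pos[of 0 k] by (simp add: p_def q_def r_def zero_le_mult_iff)
qed

section \<open>First-order expansion of the reciprocal Stieltjes transform at 0\<close>

definition I :: "real \<Rightarrow> real" where
  "I l = (\<integral> u. 1 / (l + u) \<partial>M)"

lemmas [measurable_cong] = calM_D(1)[OF M_in]

lemma inverse_St1:
  assumes "0 < l"
  shows "a * l + b + l * I l = 1 / St 1 l"
proof -
  have "(\<integral> u. l / (l + u) \<partial>M) = l * I l"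
    by (simp add: I_def flip: integral_mult_right_zero)
  then show ?thesis
    using triple[OF assms] by (simp add: St_def)
qed

lemma I_nonneg: "0 < l \<Longrightarrow> 0 \<le> I l"
  unfolding I_def using calM_D(2)[OF M_in] by (intro integral_nonneg_AE) (auto elim!: eventually_mono)

text \<open>A decreasing null sequence along which \<open>l\<close> tends to 0: decreasing for
  monotone convergence, at most 1 for domination by \<open>1 / (1 + u)\<close>.\<close>

abbreviation (input) h :: "nat \<Rightarrow> real" where
  "h i \<equiv> 1 / real (Suc i)"

lemma h_tendsto: "h \<longlonglongrightarrow> 0"
  using LIMSEQ_inverse_real_of_nat by (simp add: inverse_eq_divide)

text \<open>Order zero of the expansion: \<open>l / (l + u)\<close> is at most
  \<open>1 / (1 + u)\<close> for \<open>l \<le> 1\<close>, so the \<open>M\<close>-term vanishes in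
  the limit.\<close>

lemma b_eq: "b = 1 / St 1 0"
proof -
  have "(\<lambda>i. \<integral>u. h i / (h i + u) \<partial>M) \<longlonglongrightarrow> (\<integral>u. 0 \<partial>M)"
  proof (rule integral_dominated_convergence[where w = "\<lambda>u. 1 / (1 + u)"])
    show "integrable M (\<lambda>u. 1 / (1 + u))"
      by (rule calM_D(4)[OF M_in]) simp
    show "AE u in M. (\<lambda>i. h i / (h i + u)) \<longlonglongrightarrow> 0"
      using calM_D(2)[OF M_in]
    proof eventually_elim
      case (elim u)
      then have "(\<lambda>i. h i / (h i + u)) \<longlonglongrightarrow> 0 / (0 + u)"
        by (intro tendsto_intros h_tendsto) auto
      then show ?case
        by simp
    qed
    show "AE u in M. norm (h i / (h i + u)) \<le> 1 / (1 + u)" for i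
      using calM_D(2)[OF M_in]
    proof eventually_elim
      case (elim u)
      have "h i * u \<le> 1 * u"
        using elim by (intro mult_right_mono) auto
      moreover have "0 < h i"
        by simp
      ultimately show ?case
        using elim by (simp only: real_norm_def abs_of_nonneg divide_nonneg_nonneg add_nonneg_nonneg less_imp_le)
          (simp add: divide_le_eq le_divide_eq add_pos_pos field_simps)
    qed
  qed auto
  then have "(\<lambda>i. h i * I (h i)) \<longlonglongrightarrow> 0"
    by (simp add: I_def flip: integral_mult_right_zero)
  then have "(\<lambda>i. a * h i + b + h i * I (h i)) \<longlonglongrightarrow> a * 0 + b + 0"
    by (intro tendsto_intros h_tendsto)
  then have "(\<lambda>i. 1 / St 1 (h i)) \<longlonglongrightarrow> b"
    by (subst (asm) inverse_St1) auto
  moreover have "(\<lambda>i. 1 / St 1 (h i)) \<longlonglongrightarrow> 1 / St 1 0"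
    using St_pos[of 0 1] by (intro tendsto_intros St_tendsto h_tendsto) auto
  ultimately show ?thesis
    by (rule LIMSEQ_unique)
qed

text \<open>Order one: \<open>a + I l\<close> is the difference quotient of the reciprocal of
  \<open>St 1\<close> at 0. As \<open>St_DERIV\<close> covers only \<open>l > 0\<close>, the
  quotient is computed from \<open>1 / u - 1 / (l + u) = l / (u * (l + u))\<close>.\<close>

lemma I_tendsto: "(\<lambda>i. I (h i)) \<longlonglongrightarrow> St 2 0 / (St 1 0)\<^sup>2 - a"
proof -
  let ?D = "\<lambda>l. \<integral>u. 1 / (u * (l + u)) \<partial>m"
  have D: "?D l = (St 1 0 - St 1 l) / l" if l: "0 < l" for l
  proof -
    have "?D l = (\<integral>u. (1 / (0 + u) ^ 1 - 1 / (l + u) ^ 1) / l \<partial>m)"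
    proof (rule integral_cong_AE)
      show "AE u in m. 1 / (u * (l + u)) = (1 / (0 + u) ^ 1 - 1 / (l + u) ^ 1) / l"
        using AE_u0
      proof eventually_elim
        case (elim u)
        then have "0 < u" "0 < l + u"
          using u0_pos l by auto
        then have "1 / (u * (l + u)) * l = 1 / u - 1 / (l + u)"
          by (simp add: field_simps)
        then show ?case
          using l by (simp add: eq_divide_eq)
      qed
    qed auto
    also have "\<dots> = (St 1 0 - St 1 l) / l"
      using integrable_St[of 0 1] integrable_St[of l 1] l
      by (simp add: St_def)
    finally show ?thesis .
  qed
  have "(\<lambda>i. ?D (h i)) \<longlonglongrightarrow> St 2 0"
    unfolding St_def
  proof (rule integral_dominated_convergence[where w = "\<lambda>_. 1 / u0\<^sup>2"])
    show "AE u in m. (\<lambda>i. 1 / (u * (h i + u))) \<longlonglongrightarrow> 1 / (0 + u)\<^sup>2"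
      using AE_u0
    proof eventually_elim
      case (elim u)
      then have "(\<lambda>i. 1 / (u * (h i + u))) \<longlonglongrightarrow> 1 / (u * (0 + u))"
        using u0_pos by (intro tendsto_intros h_tendsto) auto
      then show ?case
        by (simp add: power2_eq_square)
    qed
    show "AE u in m. norm (1 / (u * (h i + u))) \<le> 1 / u0\<^sup>2" for i
      using AE_u0
    proof eventually_elim
      case (elim u)
      have hp: "0 < h i"
        by simp
      have "u0 * u0 \<le> u * (h i + u)"
        using elim u0_pos hp by (intro mult_mono) linarith+
      then have "1 / (u * (h i + u)) \<le> 1 / (u0 * u0)"
        using u0_pos mult_pos_pos[OF u0_pos u0_pos] by (intro divide_left_mono mult_pos_pos[of "u * (h i + u)"]) linarith+
      moreover have "0 \<le> 1 / (u * (h i + u))"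
        using elim u0_pos hp by (intro divide_nonneg_nonneg mult_nonneg_nonneg add_nonneg_nonneg) linarith+
      ultimately show ?case
        by (simp only: real_norm_def abs_of_nonneg power2_eq_square)
    qed
  qed auto
  then have "(\<lambda>i. ?D (h i) / (St 1 0 * St 1 (h i)) - a) \<longlonglongrightarrow> St 2 0 / (St 1 0 * St 1 0) - a"
    using St_pos[of 0 1] by (intro tendsto_intros St_tendsto h_tendsto) auto
  moreover have "?D (h i) / (St 1 0 * St 1 (h i)) - a = I (h i)" for i
  proof -
    have h: "0 < h i"
      by simp
    have "?D (h i) / (St 1 0 * St 1 (h i)) - a = (1 / St 1 (h i) - 1 / St 1 0) / h i - a"
      unfolding D[OF h] using St_pos[of 0 1] St_pos[of "h i" 1] by (simp add: field_simps)
    also have "\<dots> = I (h i)"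
      unfolding inverse_St1[OF h, symmetric] b_eq[symmetric] using h by (simp only: add_diff_cancel_left' add.commute[of _ b] add.assoc add_divide_distrib) simp
    finally show ?thesis .
  qed
  ultimately show ?thesis
    by (simp add: power2_eq_square)
qed

text \<open>Membership in \<open>calM\<close> does not control \<open>1 / u\<close> near 0.
  Integrability comes from the finite limit of \<open>I\<close> by monotone convergence.\<close>

lemma integral_M: "integrable M (\<lambda>u. 1 / u)" "(\<integral>u. 1 / u \<partial>M) = St 2 0 / (St 1 0)\<^sup>2 - a"
proof -
  have int: "integrable M (\<lambda>u. 1 / (h i + u))" for i
    by (rule calM_D(4)[OF M_in]) simp
  have mono: "AE u in M. mono (\<lambda>i. 1 / (h i + u))"
    using calM_D(2)[OF M_in]
  proof eventually_elim
    case (elim u)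
    have hp: "0 < h i" for i
      by simp
    show ?case
    proof (rule monoI)
      fix i j :: nat assume "i \<le> j"
      then have "h j \<le> h i"
        by (simp add: frac_le)
      then show "1 / (h i + u) \<le> 1 / (h j + u)"
        using elim hp[of i] hp[of j] by (intro divide_left_mono mult_pos_pos) linarith+
    qed
  qed
  have pos: "AE u in M. 0 \<le> 1 / (h i + u)" for i
    using calM_D(2)[OF M_in] by eventually_elim (simp add: add_nonneg_nonneg)
  have lim: "AE u in M. (\<lambda>i. 1 / (h i + u)) \<longlonglongrightarrow> 1 / u"
    using calM_D(2)[OF M_in]
  proof eventually_elim
    case (elim u)
    then have "(\<lambda>i. 1 / (h i + u)) \<longlonglongrightarrow> 1 / (0 + u)"
      by (intro tendsto_intros h_tendsto) auto
    then show ?case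
      by simp
  qed
  note * = integral_monotone_convergence_nonneg[OF int mono pos lim I_tendsto[unfolded I_def]]
  show "integrable M (\<lambda>u. 1 / u)" "(\<integral>u. 1 / u \<partial>M) = St 2 0 / (St 1 0)\<^sup>2 - a"
    by (rule *; measurable)+
qed

abbreviation N :: "real measure" where
  "N \<equiv> n_of M"

text \<open>The second moment of \<open>N\<close>, in the form that makes \<open>2 * a + n2\<close>
  a function of \<open>m\<close> alone.\<close>

definition n2 :: real where
  "n2 = 2 * (St 2 0 / (St 1 0)\<^sup>2 - a)"

lemma has_bochner_integral_N_square: "has_bochner_integral N (\<lambda>y. y\<^sup>2) n2"
proof (rule has_bochner_integral_nn_integral)
  have "(\<integral>\<^sup>+ y. ennreal (y\<^sup>2) \<partial>N) = (\<integral>\<^sup>+ u. ennreal (2 * (1 / u)) \<partial>M)"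
    unfolding nn_integral_n_of[OF M_in, of "\<lambda>y. y\<^sup>2", simplified]
    using calM_D(2)[OF M_in]
    by (intro nn_integral_cong_AE) (auto elim!: eventually_mono simp: nn_integral_square_exp[simplified])
  also have "\<dots> = ennreal n2"
  proof (subst nn_integral_eq_integral)
    show "integrable M (\<lambda>u. 2 * (1 / u))"
      by (rule integrable_mult_right[OF integral_M(1)])
    show "AE u in M. 0 \<le> 2 * (1 / u)"
      using calM_D(2)[OF M_in] by eventually_elim simp
    show "ennreal (\<integral>u. 2 * (1 / u) \<partial>M) = ennreal n2"
      unfolding integral_mult_right_zero integral_M n2_def ..
  qed
  finally show "(\<integral>\<^sup>+ y. ennreal (y\<^sup>2) \<partial>N) = ennreal n2" .
  have "0 \<le> (\<integral>u. 1 / u \<partial>M)"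
    using calM_D(2)[OF M_in] by (intro integral_nonneg_AE) (auto elim!: eventually_mono)
  then show "0 \<le> n2"
    by (simp add: n2_def integral_M)
qed auto

lemma n2_nonneg: "0 \<le> n2"
  using has_bochner_integral_integral_eq[OF has_bochner_integral_N_square, symmetric] by simp

lemma integral_N_exp:
  assumes l: "0 < l"
  shows "(\<integral>y. exp (- l * y) - 1 + l * y \<partial>N) = l\<^sup>2 * I l"
proof -
  have "has_bochner_integral N (\<lambda>y. exp (- l * y) - 1 + l * y) (l\<^sup>2 * I l)"
  proof (rule has_bochner_integral_nn_integral)
    have "(\<integral>\<^sup>+ y. ennreal (exp (- l * y) - 1 + l * y) \<partial>N) =
       (\<integral>\<^sup>+ u. \<integral>\<^sup>+ y. ennreal ((exp (- l * y) - 1 + l * y) * (u\<^sup>2 * exp (- u * y))) * indicator {0..} y \<partial>lborel \<partial>M)"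
      by (rule nn_integral_n_of[OF M_in])
        (use exp_ge_add_one_self[of "- l * y" for y] in \<open>auto simp: algebra_simps\<close>)
    also have "\<dots> = (\<integral>\<^sup>+ u. ennreal (l\<^sup>2 * (1 / (l + u))) \<partial>M)"
      using calM_D(2)[OF M_in] nn_integral_compensated_exp[OF _ l]
      by (intro nn_integral_cong_AE) (auto elim!: eventually_mono)
    also have "\<dots> = ennreal (l\<^sup>2 * I l)"
    proof (subst nn_integral_eq_integral)
      show "integrable M (\<lambda>u. l\<^sup>2 * (1 / (l + u)))"
        by (rule integrable_mult_right[OF calM_D(4)[OF M_in l]])
      show "AE u in M. 0 \<le> l\<^sup>2 * (1 / (l + u))"
        using calM_D(2)[OF M_in] by eventually_elim (use l in simp)
      show "ennreal (\<integral>u. l\<^sup>2 * (1 / (l + u)) \<partial>M) = ennreal (l\<^sup>2 * I l)"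
        unfolding integral_mult_right_zero I_def ..
    qed
    finally show "(\<integral>\<^sup>+ y. ennreal (exp (- l * y) - 1 + l * y) \<partial>N) = ennreal (l\<^sup>2 * I l)" .
    show "AE y in N. 0 \<le> exp (- l * y) - 1 + l * y"
      using exp_ge_add_one_self[of "- l * y" for y] by (intro AE_I2) (auto simp: algebra_simps)
  qed (use I_nonneg[OF l] in auto)
  then show ?thesis
    by (rule has_bochner_integral_integral_eq)
qed

end

subsection \<open>Truncated test functions\<close>

text \<open>Exponentials are tempered with rate \<open>l > 0\<close>, quadratic polynomials with rate \<open>l = 0\<close>.\<close>
definition tempered :: "real \<Rightarrow> real \<Rightarrow> (real \<Rightarrow> real) \<Rightarrow> (real \<Rightarrow> real) \<Rightarrow> (real \<Rightarrow> real) \<Rightarrow> bool" where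
  "tempered c l f f1 f2 \<longleftrightarrow> 0 \<le> c \<and> 0 \<le> l
     \<and> (\<forall>x. (f has_real_derivative f1 x) (at x)) \<and> (\<forall>x. (f1 has_real_derivative f2 x) (at x))
     \<and> continuous_on UNIV f2
     \<and> (\<forall>x\<ge>0. \<bar>f x\<bar> \<le> c * exp (- l * x) * (1 + x)\<^sup>2 \<and> \<bar>f1 x\<bar> \<le> c * exp (- l * x) * (1 + x)
              \<and> \<bar>f2 x\<bar> \<le> c * exp (- l * x))"

lemma temperedD:
  assumes "tempered c l f f1 f2"
  shows "0 \<le> c" "0 \<le> l" "(f has_real_derivative f1 x) (at x)" "(f1 has_real_derivative f2 x) (at x)"
    "continuous_on UNIV f2" "deriv f = f1" "deriv f1 = f2"
    "0 \<le> x \<Longrightarrow> \<bar>f x\<bar> \<le> c * exp (- l * x) * (1 + x)\<^sup>2"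
    "0 \<le> x \<Longrightarrow> \<bar>f1 x\<bar> \<le> c * exp (- l * x) * (1 + x)"
    "0 \<le> x \<Longrightarrow> \<bar>f2 x\<bar> \<le> c * exp (- l * x)"
  using assms by (auto simp: tempered_def intro!: ext DERIV_imp_deriv)

lemma tempered_measurable:
  assumes "tempered c l f f1 f2"
  shows "f \<in> borel_measurable borel" "f1 \<in> borel_measurable borel" "f2 \<in> borel_measurable borel"
  using temperedD(3-5)[OF assms]
  by (auto intro!: borel_measurable_continuous_onI continuous_at_imp_continuous_on DERIV_isCont)

definition trunc :: "real \<Rightarrow> (real \<Rightarrow> real) \<Rightarrow> real \<Rightarrow> real" where
  "trunc R f x = f x * cutoff (x / R)"

definition trunc1 :: "real \<Rightarrow> (real \<Rightarrow> real) \<Rightarrow> (real \<Rightarrow> real) \<Rightarrow> real \<Rightarrow> real" where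
  "trunc1 R f f1 x = f1 x * cutoff (x / R) + f x * (cutoff1 (x / R) / R)"

definition trunc2 :: "real \<Rightarrow> (real \<Rightarrow> real) \<Rightarrow> (real \<Rightarrow> real) \<Rightarrow> (real \<Rightarrow> real) \<Rightarrow> real \<Rightarrow> real" where
  "trunc2 R f f1 f2 x = f2 x * cutoff (x / R) + 2 * (f1 x * (cutoff1 (x / R) / R)) + f x * (cutoff2 (x / R) / R\<^sup>2)"

text \<open>What matters is that the constant \<open>121 = 1 + 2 * 2 * 6 + 4 * 24\<close> does not depend on \<open>R\<close>: the derivatives of the cutoff
  live where \<open>1 + x \<le> 2 * R\<close>.\<close>
lemma tempered_trunc:
  assumes f: "tempered c l f f1 f2" and R: "1 \<le> R"
  shows "tempered (121 * c) l (trunc R f) (trunc1 R f f1) (trunc2 R f f1 f2)"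
  unfolding tempered_def
proof (intro conjI allI impI)
  show "0 \<le> 121 * c" "0 \<le> l"
    using temperedD(1,2)[OF f] by auto
  have dR: "((\<lambda>x. x / R) has_real_derivative 1 / R) (at x)" for x
    using R by (auto intro!: derivative_eq_intros)
  note d = DERIV_chain2[OF DERIV_cutoff dR] DERIV_chain2[OF DERIV_cutoff1 dR]
  note d1 = DERIV_cdivide[OF d(2), where c = R]
  show "(trunc R f has_real_derivative trunc1 R f f1 x) (at x)" for x
    unfolding trunc_def[abs_def] trunc1_def
    by (rule DERIV_cong[OF DERIV_mult[OF temperedD(3)[OF f] d(1)]]) simp
  show "(trunc1 R f f1 has_real_derivative trunc2 R f f1 f2 x) (at x)" for x
    unfolding trunc1_def[abs_def] trunc2_def
    by (rule DERIV_cong[OF DERIV_add[OF DERIV_mult[OF temperedD(4)[OF f] d(1)] DERIV_mult[OF temperedD(3)[OF f] d1]]])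
      (simp add: power2_eq_square)
  have cont: "continuous_on UNIV f" "continuous_on UNIV f1"
    using temperedD(3,4)[OF f] by (auto intro!: continuous_at_imp_continuous_on DERIV_isCont)
  have div: "continuous_on UNIV (\<lambda>x. x / R)"
    by (cases "R = 0") (auto intro!: continuous_intros)
  have cc: "continuous_on UNIV (\<lambda>x. cutoff (x / R))" "continuous_on UNIV (\<lambda>x. cutoff1 (x / R))"
    using d by (auto intro!: continuous_at_imp_continuous_on DERIV_isCont)
  have cc2: "continuous_on UNIV (\<lambda>x. cutoff2 (x / R))"
    by (rule continuous_on_compose2[OF continuous_on_cutoff2 div subset_UNIV])
  show "continuous_on UNIV (trunc2 R f f1 f2)"
    unfolding trunc2_def[abs_def] divide_inverse[of "cutoff1 _"] divide_inverse[of "cutoff2 _"]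
    by (intro continuous_on_add continuous_on_mult continuous_on_const temperedD(5)[OF f] cont cc cc2)
  fix x :: real assume x: "0 \<le> x"
  define e where "e = c * exp (- l * x)"
  have e0: "0 \<le> e"
    using temperedD(1)[OF f] by (simp add: e_def)
  have fb: "\<bar>f x\<bar> \<le> e * (1 + x)\<^sup>2" "\<bar>f1 x\<bar> \<le> e * (1 + x)" "\<bar>f2 x\<bar> \<le> e"
    using temperedD(8-10)[OF f x] by (simp_all add: e_def)
  have "\<bar>trunc R f x\<bar> \<le> 121 * e * (1 + x)\<^sup>2 \<and> \<bar>trunc1 R f f1 x\<bar> \<le> 121 * e * (1 + x) \<and> \<bar>trunc2 R f f1 f2 x\<bar> \<le> 121 * e"
  proof (cases "R \<le> x")
    case True
    then have "1 \<le> \<bar>x / R\<bar>"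
      using R by simp
    then show ?thesis
      using e0 x by (simp add: trunc_def trunc1_def trunc2_def cutoff_eq_0)
  next
    case False
    \<comment> \<open>Each derivative that falls on the cutoff brings a factor \<open>1 / R\<close>,
      which turns one power of \<open>1 + x\<close> in the bound into \<open>w\<close>.\<close>
    define w where "w = (1 + x) / R"
    have w: "0 \<le> w" "w \<le> 2"
      using x R False by (auto simp: w_def field_simps)
    have w2: "w\<^sup>2 \<le> 4"
      using power_mono[OF w(2,1), of 2] by simp
    have m0: "\<bar>f x * cutoff (x / R)\<bar> \<le> e * (1 + x)\<^sup>2 * 1" "\<bar>f1 x * cutoff (x / R)\<bar> \<le> e * (1 + x) * 1"
      "\<bar>f2 x * cutoff (x / R)\<bar> \<le> e * 1"
      unfolding abs_mult using fb cutoff_bound(1) e0 x by (intro mult_mono; force)+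
    have fR: "\<bar>f x / R\<bar> \<le> e * (1 + x) * w" "\<bar>f1 x / R\<bar> \<le> e * w" "\<bar>f x / R\<^sup>2\<bar> \<le> e * w\<^sup>2"
      using fb R by (auto simp: w_def divide_right_mono power_divide power2_eq_square mult_ac)
    have "\<bar>f x / R * cutoff1 (x / R)\<bar> \<le> e * (1 + x) * w * 6" "\<bar>f1 x / R * cutoff1 (x / R)\<bar> \<le> e * w * 6"
      "\<bar>f x / R\<^sup>2 * cutoff2 (x / R)\<bar> \<le> e * w\<^sup>2 * 24"
      unfolding abs_mult using fR cutoff_bound(2,3) e0 x w by (intro mult_mono; force)+
    then have "\<bar>f x * (cutoff1 (x / R) / R)\<bar> \<le> e * (1 + x) * w * 6" "\<bar>f1 x * (cutoff1 (x / R) / R)\<bar> \<le> e * w * 6"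
      "\<bar>f x * (cutoff2 (x / R) / R\<^sup>2)\<bar> \<le> e * w\<^sup>2 * 24"
      by simp_all
    moreover have "e * (1 + x) * w \<le> e * (1 + x) * 2" "e * w \<le> e * 2" "e * w\<^sup>2 \<le> e * 4"
      using e0 x w w2 by (intro mult_left_mono; simp)+
    moreover have "0 \<le> e * (1 + x)" "0 \<le> e * (1 + x)\<^sup>2"
      using e0 x by auto
    ultimately show ?thesis
      using m0 e0 unfolding trunc_def trunc1_def trunc2_def
      by (intro conjI; linarith)
  qed
  then show "\<bar>trunc R f x\<bar> \<le> 121 * c * exp (- l * x) * (1 + x)\<^sup>2" "\<bar>trunc1 R f f1 x\<bar> \<le> 121 * c * exp (- l * x) * (1 + x)"
    "\<bar>trunc2 R f f1 f2 x\<bar> \<le> 121 * c * exp (- l * x)"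
    by (simp_all add: e_def mult.assoc)
qed

lemma trunc_core:
  assumes f: "tempered c l f f1 f2" and R: "1 \<le> R"
  shows "trunc R f \<in> cbci_core"
proof -
  note t = tempered_trunc[OF f R]
  have "trunc R f x = 0" if "x \<notin> {- R..R}" for x
  proof -
    have "R \<le> \<bar>x\<bar>"
      using that by auto
    then show ?thesis
      using R by (simp add: trunc_def cutoff_eq_0 le_divide_eq)
  qed
  then show ?thesis
    unfolding cbci_core_def mem_Collect_eq temperedD(6,7)[OF t]
    using temperedD(3-5)[OF t]
    by (auto intro!: exI[of _ "{- R..R}"] simp: real_differentiable_def)
qed

lemma trunc_tendsto:
  "(\<lambda>i. trunc (real (Suc i)) f x) \<longlonglongrightarrow> f x"
  "(\<lambda>i. trunc1 (real (Suc i)) f f1 x) \<longlonglongrightarrow> f1 x"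
  "(\<lambda>i. trunc2 (real (Suc i)) f f1 f2 x) \<longlonglongrightarrow> f2 x"
proof -
  have h: "(\<lambda>i. 1 / real (Suc i)) \<longlonglongrightarrow> 0"
    using LIMSEQ_inverse_real_of_nat by (simp add: inverse_eq_divide)
  then have s: "(\<lambda>i. x / real (Suc i)) \<longlonglongrightarrow> 0"
    using tendsto_mult_right_zero[of _ _ x] by fastforce
  have c0: "(\<lambda>i. cutoff (x / real (Suc i))) \<longlonglongrightarrow> 1"
    using isCont_tendsto_compose[OF DERIV_isCont[OF DERIV_cutoff] s] by (simp add: cutoff_def)
  have c1: "(\<lambda>i. cutoff1 (x / real (Suc i)) * (1 / real (Suc i))) \<longlonglongrightarrow> 0"
    using tendsto_mult[OF isCont_tendsto_compose[OF DERIV_isCont[OF DERIV_cutoff1] s] h] by simp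
  have c2': "(\<lambda>i. cutoff2 (x / real (Suc i)) * (1 / real (Suc i)) * (1 / real (Suc i))) \<longlonglongrightarrow> cutoff2 0 * 0 * 0"
    by (intro tendsto_mult h isCont_tendsto_compose[OF _ s])
      (use continuous_on_cutoff2[of UNIV] in \<open>simp add: continuous_on_eq_continuous_at\<close>)
  then have c2: "(\<lambda>i. cutoff2 (x / real (Suc i)) / (real (Suc i))\<^sup>2) \<longlonglongrightarrow> 0"
    by (simp add: power2_eq_square)
  have c1: "(\<lambda>i. cutoff1 (x / real (Suc i)) / real (Suc i)) \<longlonglongrightarrow> 0"
    using c1 by simp
  show "(\<lambda>i. trunc (real (Suc i)) f x) \<longlonglongrightarrow> f x"
    using tendsto_mult[OF tendsto_const[of "f x"] c0] by (simp add: trunc_def)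
  show "(\<lambda>i. trunc1 (real (Suc i)) f f1 x) \<longlonglongrightarrow> f1 x"
    using tendsto_add[OF tendsto_mult[OF tendsto_const[of "f1 x"] c0] tendsto_mult[OF tendsto_const[of "f x"] c1]]
    by (simp add: trunc1_def)
  show "(\<lambda>i. trunc2 (real (Suc i)) f f1 f2 x) \<longlonglongrightarrow> f2 x"
    using tendsto_add[OF tendsto_add[OF tendsto_mult[OF tendsto_const[of "f2 x"] c0]
        tendsto_mult[OF tendsto_const[of 2] tendsto_mult[OF tendsto_const[of "f1 x"] c1]]]
        tendsto_mult[OF tendsto_const[of "f x"] c2]]
    by (simp add: trunc2_def)
qed

section \<open>The generator on tempered functions\<close>

context cbci_triple
begin

abbreviation L :: "(real \<Rightarrow> real) \<Rightarrow> real \<Rightarrow> real" where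
  "L \<equiv> cbciL a b N"

lemma L_tempered:
  assumes "tempered c l f f1 f2"
  shows "L f x = a * x * f2 x - b * x * f1 x + x * (\<integral> y. f (x + y) - f x - y * f1 x \<partial>N) + f1 x"
  unfolding cbciL_def temperedD(6,7)[OF assms] ..

lemma sigma_finite_N: "sigma_finite_measure N"
proof (rule sigma_finite_of_nn_integral_pos)
  show "(\<lambda>y. ennreal (y\<^sup>2)) \<in> borel_measurable N"
    by simp
  show "(\<integral>\<^sup>+ y. ennreal (y\<^sup>2) \<partial>N) < \<infinity>"
    using has_bochner_integral_N_square by (auto elim!: integrableE simp: has_bochner_integral_iff integrable_iff_bounded)
  show "AE y in N. 0 < ennreal (y\<^sup>2)"
    using AE_n_of_pos[OF M_in] by eventually_elim simp
qed

lemma L_measurable: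
  assumes f: "tempered c l f f1 f2"
  shows "L f \<in> borel_measurable borel"
proof -
  interpret N: sigma_finite_measure N
    by (rule sigma_finite_N)
  note [measurable] = tempered_measurable[OF f]
  show ?thesis
    unfolding L_tempered[OF f, abs_def] by measurable
qed

text \<open>Since \<open>exp (- l * z)\<close> decreases in \<open>z\<close>, the bound on
  \<open>f2\<close> at \<open>x\<close> persists at every point that an upward jump passes.\<close>

lemma AE_jump_bound:
  assumes f: "tempered c l f f1 f2" and x: "0 \<le> x"
  shows "AE y in N. norm (f (x + y) - f x - y * f1 x) \<le> c * exp (- l * x) / 2 * y\<^sup>2"
  using AE_n_of_pos[OF M_in]
proof eventually_elim
  case (elim y)
  have "\<bar>f2 z\<bar> \<le> c * exp (- l * x)" if "x \<le> z" for z
  proof -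
    have "\<bar>f2 z\<bar> \<le> c * exp (- l * z)"
      using temperedD(10)[OF f, of z] x that by simp
    also have "\<dots> \<le> c * exp (- l * x)"
      using temperedD(1,2)[OF f] that by (intro mult_left_mono) (auto intro: mult_left_mono)
    finally show ?thesis .
  qed
  then show ?case
    using elim temperedD(3,4)[OF f] unfolding real_norm_def by (intro Taylor2_bound) auto
qed

lemma integrable_N_square: "integrable N (\<lambda>y. C * y\<^sup>2)"
  using has_bochner_integral_N_square by (auto simp: has_bochner_integral_iff)

lemma integral_N_square: "(\<integral>y. C * y\<^sup>2 \<partial>N) = C * n2"
  using has_bochner_integral_N_square by (auto simp: has_bochner_integral_iff)

text \<open>\<open>L\<close> preserves the weight of \<open>f\<close>, and the bound is linear in
  \<open>c\<close>. Truncations share the constant \<open>121 * c\<close>, so this yields a majorant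
  for all \<open>R\<close> at once.\<close>

lemma L_bound:
  assumes f: "tempered c l f f1 f2" and x: "0 \<le> x"
  shows "\<bar>L f x\<bar> \<le> (a + b + n2 + 1) * c * (exp (- l * x) * (1 + x)\<^sup>2)"
proof -
  note [measurable] = tempered_measurable[OF f]
  define e where "e = c * exp (- l * x)"
  have e0: "0 \<le> e"
    using temperedD(1)[OF f] by (simp add: e_def)
  have fb: "\<bar>f1 x\<bar> \<le> e * (1 + x)" "\<bar>f2 x\<bar> \<le> e"
    using temperedD(9,10)[OF f x] by (simp_all add: e_def)
  let ?J = "\<integral> y. f (x + y) - f x - y * f1 x \<partial>N"
  note J = AE_jump_bound[OF f x, folded e_def]
  have int: "integrable N (\<lambda>y. f (x + y) - f x - y * f1 x)"
    by (rule Bochner_Integration.integrable_bound[OF integrable_N_square[of "e / 2"]])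
      (use J in \<open>auto elim!: eventually_mono\<close>)
  have "\<bar>?J\<bar> \<le> (\<integral> y. norm (f (x + y) - f x - y * f1 x) \<partial>N)"
    using integral_norm_bound[of N "\<lambda>y. f (x + y) - f x - y * f1 x"] by simp
  also have "\<dots> \<le> (\<integral> y. e / 2 * y\<^sup>2 \<partial>N)"
    by (rule integral_mono_AE[OF integrable_norm[OF int] integrable_N_square J])
  also have "\<dots> \<le> e * n2"
    using e0 n2_nonneg unfolding integral_N_square by (simp add: mult_nonneg_nonneg)
  finally have J: "\<bar>?J\<bar> \<le> e * n2" .
  have x1: "x \<le> (1 + x)\<^sup>2" "x * (1 + x) \<le> (1 + x)\<^sup>2" "1 + x \<le> (1 + x)\<^sup>2"
    using x by (auto simp: power2_eq_square algebra_simps add_increasing2)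
  have "\<bar>L f x\<bar> \<le> \<bar>a * x * f2 x\<bar> + \<bar>b * x * f1 x\<bar> + \<bar>x * ?J\<bar> + \<bar>f1 x\<bar>"
    unfolding L_tempered[OF f] by linarith
  also have "\<dots> = a * x * \<bar>f2 x\<bar> + b * x * \<bar>f1 x\<bar> + x * \<bar>?J\<bar> + \<bar>f1 x\<bar>"
    using a_pos b_pos x by (simp add: abs_mult)
  also have "\<dots> \<le> a * x * e + b * x * (e * (1 + x)) + x * (e * n2) + e * (1 + x)"
    using fb J a_pos b_pos x by (intro add_mono mult_left_mono) auto
  also have "\<dots> = (a * e) * x + (b * e) * (x * (1 + x)) + (e * n2) * x + e * (1 + x)"
    by (simp add: algebra_simps)
  also have "\<dots> \<le> (a * e) * (1 + x)\<^sup>2 + (b * e) * (1 + x)\<^sup>2 + (e * n2) * (1 + x)\<^sup>2 + e * (1 + x)\<^sup>2"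
    using x1 a_pos b_pos n2_nonneg e0 by (intro add_mono mult_left_mono) auto
  finally show ?thesis
    by (simp add: e_def algebra_simps)
qed

text \<open>The jump integral is nonlocal and sees the truncation for every \<open>R\<close>; it
  converges by domination with a multiple of \<open>y\<^sup>2\<close>.\<close>

lemma L_trunc_tendsto:
  assumes f: "tempered c l f f1 f2" and x: "0 \<le> x"
  shows "(\<lambda>i. L (trunc (real (Suc i)) f) x) \<longlonglongrightarrow> L f x"
proof -
  let ?F = "\<lambda>i. trunc (real (Suc i)) f" and ?F1 = "\<lambda>i. trunc1 (real (Suc i)) f f1"
  have t: "tempered (121 * c) l (?F i) (?F1 i) (trunc2 (real (Suc i)) f f1 f2)" for i
    by (rule tempered_trunc[OF f]) simp
  note [measurable] = tempered_measurable[OF f] tempered_measurable[OF t]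
  have "(\<lambda>i. \<integral> y. ?F i (x + y) - ?F i x - y * ?F1 i x \<partial>N) \<longlonglongrightarrow> (\<integral> y. f (x + y) - f x - y * f1 x \<partial>N)"
  proof (rule integral_dominated_convergence)
    show "AE y in N. (\<lambda>i. ?F i (x + y) - ?F i x - y * ?F1 i x) \<longlonglongrightarrow> f (x + y) - f x - y * f1 x"
      by (intro AE_I2 tendsto_intros trunc_tendsto)
    show "AE y in N. norm (?F i (x + y) - ?F i x - y * ?F1 i x) \<le> 121 * c * exp (- l * x) / 2 * y\<^sup>2" for i
      by (rule AE_jump_bound[OF t x])
    show "(\<lambda>y. ?F i (x + y) - ?F i x - y * ?F1 i x) \<in> borel_measurable N" for i
      by measurable
    show "(\<lambda>y. f (x + y) - f x - y * f1 x) \<in> borel_measurable N"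
      by measurable
  qed (rule integrable_N_square)
  then show ?thesis
    unfolding L_tempered[OF f] L_tempered[OF t] by (intro tendsto_intros trunc_tendsto)
qed

end

subsection \<open>Moments of the stationary distribution\<close>

text \<open>A single term of the exponential series of \<open>l * x\<close> is at most the whole
  sum.\<close>

lemma power_times_exp_bound:
  fixes x l :: real
  assumes "0 \<le> x" "0 < l"
  shows "x ^ k * exp (- l * x) \<le> fact k / l ^ k"
proof -
  have "(l * x) ^ k /\<^sub>R fact k = (\<Sum>n\<in>{k}. (l * x) ^ n /\<^sub>R fact n)"
    by simp
  also have "\<dots> \<le> exp (l * x)"
    unfolding exp_def using assms by (intro sum_le_suminf summable_exp_generic) auto
  finally have "l ^ k * x ^ k \<le> fact k * exp (l * x)"
    by (simp add: power_mult_distrib field_simps)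
  then show ?thesis
    using assms by (simp add: exp_minus field_simps)
qed

locale cbci_stationary_triple = cbci_triple +
  fixes \<nu> :: "real measure"
  assumes stat: "cbci_stationary a b N \<nu>"
begin

lemma sets_nu [measurable_cong, simp]: "sets \<nu> = sets borel"
  using stat by (simp add: cbci_stationary_def)

sublocale nu: prob_space \<nu>
  using stat by (simp add: cbci_stationary_def)

lemma AE_nu_nonneg: "AE x in \<nu>. 0 \<le> x"
proof (rule AE_I)
  show "emeasure \<nu> {..<0} = 0"
    using stat by (simp add: cbci_stationary_def)
qed auto

lemma integral_L_core: "f \<in> cbci_core \<Longrightarrow> (\<integral>x. L f x \<partial>\<nu>) = 0"
  using stat by (simp add: cbci_stationary_def)

text \<open>Stationarity passes from the truncations to \<open>f\<close> under the majorant of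
  \<open>L_bound\<close>. For \<open>l > 0\<close> its weight is bounded on the half-line, so the
  integrability hypothesis can be met before any moment of \<open>\<nu>\<close> is known.\<close>

lemma integral_L_tempered:
  assumes f: "tempered c l f f1 f2" and int: "integrable \<nu> (\<lambda>x. exp (- l * x) * (1 + x)\<^sup>2)"
  shows "(\<integral>x. L f x \<partial>\<nu>) = 0"
proof -
  let ?F = "\<lambda>i. trunc (real (Suc i)) f"
  have t: "tempered (121 * c) l (?F i) (trunc1 (real (Suc i)) f f1) (trunc2 (real (Suc i)) f f1 f2)" for i
    by (rule tempered_trunc[OF f]) simp
  note [measurable] = L_measurable[OF f] L_measurable[OF t]
  have "(\<lambda>i. \<integral>x. L (?F i) x \<partial>\<nu>) \<longlonglongrightarrow> (\<integral>x. L f x \<partial>\<nu>)"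
  proof (rule integral_dominated_convergence)
    show "AE x in \<nu>. (\<lambda>i. L (?F i) x) \<longlonglongrightarrow> L f x"
      using AE_nu_nonneg by eventually_elim (rule L_trunc_tendsto[OF f])
    show "AE x in \<nu>. norm (L (?F i) x) \<le> (a + b + n2 + 1) * (121 * c) * (exp (- l * x) * (1 + x)\<^sup>2)" for i
      using AE_nu_nonneg by eventually_elim (use L_bound[OF t] in simp)
    show "integrable \<nu> (\<lambda>x. (a + b + n2 + 1) * (121 * c) * (exp (- l * x) * (1 + x)\<^sup>2))"
      using int by (rule integrable_mult_right)
    show "L f \<in> borel_measurable \<nu>"
      by measurable
    show "L (?F i) \<in> borel_measurable \<nu>" for i
      by measurable
  qed
  moreover have "(\<integral>x. L (?F i) x \<partial>\<nu>) = 0" for i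
    by (rule integral_L_core[OF trunc_core[OF f]]) simp
  ultimately show ?thesis
    by (simp add: LIMSEQ_const_iff)
qed

text \<open>With \<open>l = 0\<close> both factors are bounded by multiples of
  \<open>(1 + x)\<^sup>2\<close>, which is where the fourth moment comes in.\<close>

lemma cbciE_trunc_tendsto:
  assumes f: "tempered c 0 f f1 f2" and g: "tempered d 0 g g1 g2" and int: "integrable \<nu> (\<lambda>x. (1 + x) ^ 4)"
  shows "(\<lambda>i. cbciE a b N \<nu> (trunc (real (Suc i)) f) (trunc (real (Suc i)) g)) \<longlonglongrightarrow> (\<integral>x. (- L f x) * g x \<partial>\<nu>)"
  unfolding cbciE_def
proof (rule integral_dominated_convergence)
  let ?F = "\<lambda>i. trunc (real (Suc i)) f"
  let ?G = "\<lambda>i. trunc (real (Suc i)) g"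
  let ?K = "(a + b + n2 + 1) * (121 * c)"
  have t: "tempered (121 * c) 0 (?F i) (trunc1 (real (Suc i)) f f1) (trunc2 (real (Suc i)) f f1 f2)" for i
    by (rule tempered_trunc[OF f]) simp
  have u: "tempered (121 * d) 0 (?G i) (trunc1 (real (Suc i)) g g1) (trunc2 (real (Suc i)) g g1 g2)" for i
    by (rule tempered_trunc[OF g]) simp
  note [measurable] = L_measurable[OF f] L_measurable[OF t] tempered_measurable[OF g] tempered_measurable[OF u]
  show "(\<lambda>x. - L f x * g x) \<in> borel_measurable \<nu>"
    by measurable
  show "(\<lambda>x. - L (?F i) x * ?G i x) \<in> borel_measurable \<nu>" for i
    by measurable
  show "AE x in \<nu>. (\<lambda>i. - L (?F i) x * ?G i x) \<longlonglongrightarrow> - L f x * g x"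
    using AE_nu_nonneg
    by eventually_elim (intro tendsto_intros trunc_tendsto L_trunc_tendsto[OF f])
  show "integrable \<nu> (\<lambda>x. ?K * (121 * d) * (1 + x) ^ 4)"
    using int by (rule integrable_mult_right)
  show "AE x in \<nu>. norm (- L (?F i) x * ?G i x) \<le> ?K * (121 * d) * (1 + x) ^ 4" for i
    using AE_nu_nonneg
  proof eventually_elim
    case (elim x)
    have F: "\<bar>L (?F i) x\<bar> \<le> ?K * (1 + x)\<^sup>2"
      using L_bound[OF t elim, of i] by simp
    have "\<bar>L (?F i) x\<bar> * \<bar>?G i x\<bar> \<le> (?K * (1 + x)\<^sup>2) * (121 * d * (1 + x)\<^sup>2)"
      using temperedD(8)[OF u elim, of i] by (intro mult_mono F order_trans[OF abs_ge_zero F]) auto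
    also have "\<dots> = ?K * (121 * d) * (1 + x) ^ 4"
      by (simp add: power2_eq_square power4_eq_xxxx)
    finally show ?case
      by (simp only: real_norm_def abs_mult abs_minus_cancel)
  qed
qed

section \<open>Derivatives of the Laplace transform of the stationary law\<close>

text \<open>For \<open>l > 0\<close>, \<open>(- 1) ^ k\<close> times the \<open>k\<close>-th
  derivative of the Laplace transform of \<open>\<nu>\<close>.\<close>

definition G :: "nat \<Rightarrow> real \<Rightarrow> real" where
  "G k l = (\<integral>x. x ^ k * exp (- l * x) \<partial>\<nu>)"

lemma integrable_G:
  assumes "0 < l"
  shows "integrable \<nu> (\<lambda>x. x ^ k * exp (- l * x))"
proof (rule nu.integrable_const_bound)
  show "AE x in \<nu>. norm (x ^ k * exp (- l * x)) \<le> fact k / l ^ k"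
    using AE_nu_nonneg by eventually_elim (use power_times_exp_bound[OF _ assms] in simp)
qed measurable

lemma G_DERIV:
  assumes l: "0 < l"
  shows "(G k has_real_derivative - G (Suc k) l) (at l)"
proof -
  have "(G k has_real_derivative (\<integral>x. - (x ^ Suc k * exp (- l * x)) \<partial>\<nu>)) (at l)"
    unfolding G_def[abs_def]
  \<comment> \<open>Radius \<open>l / 2\<close> keeps the rate \<open>s\<close> above
    \<open>l / 2\<close>, so that a constant dominates the derivative.\<close>
  proof (rule has_real_derivative_integral[where e = "l / 2" and w = "\<lambda>_. fact (Suc k) / (l / 2) ^ Suc k"])
    show "0 < l / 2"
      using l by simp
    show "integrable \<nu> (\<lambda>x. x ^ k * exp (- s * x))" if "\<bar>s - l\<bar> < l / 2" for s
      using that l by (intro integrable_G) linarith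
    show "AE x in \<nu>. \<forall>s. \<bar>s - l\<bar> < l / 2 \<longrightarrow>
       ((\<lambda>s. x ^ k * exp (- s * x)) has_real_derivative - (x ^ Suc k * exp (- s * x))) (at s) \<and>
       \<bar>- (x ^ Suc k * exp (- s * x))\<bar> \<le> fact (Suc k) / (l / 2) ^ Suc k"
      using AE_nu_nonneg
    proof eventually_elim
      case (elim x)
      show ?case
      proof (intro allI impI conjI)
        fix s assume s: "\<bar>s - l\<bar> < l / 2"
        show "((\<lambda>s. x ^ k * exp (- s * x)) has_real_derivative - (x ^ Suc k * exp (- s * x))) (at s)"
          by (auto intro!: derivative_eq_intros)
        have "\<bar>- (x ^ Suc k * exp (- s * x))\<bar> = x ^ Suc k * exp (- s * x)"
          using elim by simp
        also have "\<dots> \<le> x ^ Suc k * exp (- (l / 2) * x)"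
        proof (intro mult_left_mono)
          have "l / 2 * x \<le> s * x"
            using s elim by (intro mult_right_mono) linarith+
          then show "exp (- s * x) \<le> exp (- (l / 2) * x)"
            by simp
        qed (use elim in simp)
        also have "\<dots> \<le> fact (Suc k) / (l / 2) ^ Suc k"
          using l elim by (intro power_times_exp_bound) auto
        finally show "\<bar>- (x ^ Suc k * exp (- s * x))\<bar> \<le> fact (Suc k) / (l / 2) ^ Suc k" .
      qed
    qed
  qed auto
  then show ?thesis
    by (simp add: G_def)
qed

lemma G_1:
  assumes l: "0 < l"
  shows "G 1 l = St 1 l * G 0 l"
proof -
  let ?e = "\<lambda>x. exp (- l * x)"
  \<comment> \<open>\<open>1 + l\<^sup>2\<close> is a common upper bound for \<open>1\<close>,
    \<open>l\<close> and \<open>l\<^sup>2\<close>, the factors in the function and its two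
    derivatives.\<close>
  have tempered_exp: "tempered (1 + l\<^sup>2) l ?e (\<lambda>x. - l * ?e x) (\<lambda>x. l\<^sup>2 * ?e x)"
    unfolding tempered_def
  proof (intro conjI allI impI)
    show "(?e has_real_derivative - l * ?e x) (at x)" "((\<lambda>x. - l * ?e x) has_real_derivative l\<^sup>2 * ?e x) (at x)" for x
      by (auto intro!: derivative_eq_intros simp: power2_eq_square)
    show "continuous_on UNIV (\<lambda>x. l\<^sup>2 * ?e x)"
      by (intro continuous_on_mult continuous_on_exp continuous_on_const continuous_on_id)
    fix x :: real assume x: "0 \<le> x"
    have "0 \<le> (l - 1)\<^sup>2"
      by simp
    then have l2: "l \<le> 1 + l\<^sup>2"
      using l by (simp add: power2_eq_square algebra_simps)
    have x1: "1 \<le> 1 + x" "1 \<le> (1 + x)\<^sup>2"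
      using x by (auto simp: one_le_power)
    have "1 * 1 \<le> (1 + l\<^sup>2) * (1 + x)\<^sup>2" "l * 1 \<le> (1 + l\<^sup>2) * (1 + x)"
      by (rule mult_mono; use l2 x1 l in simp)+
    moreover have "l\<^sup>2 \<le> 1 + l\<^sup>2"
      by simp
    ultimately have "1 * 1 \<le> (1 + l\<^sup>2) * (1 + x)\<^sup>2" "l * 1 \<le> (1 + l\<^sup>2) * (1 + x)" "l\<^sup>2 \<le> 1 + l\<^sup>2"
      by blast+
    from this[THEN mult_right_mono[of _ _ "?e x"]]
    show "\<bar>?e x\<bar> \<le> (1 + l\<^sup>2) * ?e x * (1 + x)\<^sup>2" "\<bar>- l * ?e x\<bar> \<le> (1 + l\<^sup>2) * ?e x * (1 + x)"
      "\<bar>l\<^sup>2 * ?e x\<bar> \<le> (1 + l\<^sup>2) * ?e x"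
      using l by (simp_all add: abs_mult mult_ac)
  qed (use l in auto)
  have "?e x * (1 + x)\<^sup>2 = x ^ 0 * ?e x + 2 * (x ^ 1 * ?e x) + x ^ 2 * ?e x" for x
    by (simp add: power2_eq_square algebra_simps)
  then have "integrable \<nu> (\<lambda>x. ?e x * (1 + x)\<^sup>2)"
    by (simp only:) (intro Bochner_Integration.integrable_add integrable_mult_right integrable_G l)
  note zero = integral_L_tempered[OF tempered_exp this]
  \<comment> \<open>Diffusion, drift and jumps together contribute
    \<open>l * (a * l + b + l * I l) * x\<close>, whose bracket is the reciprocal of
    \<open>St 1 l\<close>; the immigration term \<open>deriv f x\<close> contributes
    \<open>- l\<close>.\<close>
  have Le: "L ?e x = l / St 1 l * (x ^ 1 * ?e x) - l * (x ^ 0 * ?e x)" for x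
  proof -
    have "(\<integral>y. ?e (x + y) - ?e x - y * (- l * ?e x) \<partial>N) = (\<integral>y. ?e x * (?e y - 1 + l * y) \<partial>N)"
      by (rule Bochner_Integration.integral_cong) (simp_all add: algebra_simps flip: exp_add)
    also have "\<dots> = ?e x * (l\<^sup>2 * I l)"
      by (simp only: integral_mult_right_zero integral_N_exp[OF l])
    finally have "L ?e x = a * x * (l\<^sup>2 * ?e x) - b * x * (- l * ?e x) + x * (?e x * (l\<^sup>2 * I l)) + - l * ?e x"
      by (simp only: L_tempered[OF tempered_exp])
    also have "\<dots> = l * (a * l + b + l * I l) * (x * ?e x) - l * ?e x"
      by (simp add: algebra_simps power2_eq_square)
    finally show ?thesis
      unfolding inverse_St1[OF l] by simp
  qed
  have "0 = (\<integral>x. l / St 1 l * (x ^ 1 * ?e x) - l * (x ^ 0 * ?e x) \<partial>\<nu>)"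
    using zero unfolding Le by simp
  also have "\<dots> = l / St 1 l * G 1 l - l * G 0 l"
    unfolding G_def
    by (subst Bochner_Integration.integral_diff) (auto intro!: integrable_mult_right integrable_G l simp only: integral_mult_right_zero)
  finally show ?thesis
    using l St_pos[of l 1] by (simp add: field_simps)
qed

lemma DERIV_eq_on_pos:
  fixes f g :: "real \<Rightarrow> real"
  assumes eq: "\<And>x. 0 < x \<Longrightarrow> f x = g x" and x: "0 < x"
    and f: "(f has_real_derivative D) (at x)" and g: "(g has_real_derivative E) (at x)"
  shows "D = E"
proof -
  have "(f has_real_derivative E) (at x)"
    by (rule has_field_derivative_transform_within_open[OF g, where S = "{0<..}"]) (use eq x in auto)
  then show ?thesis
    using f by (rule DERIV_unique[rotated])
qed

text \<open>This and the next two are cases of the moment-cumulant recursion: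
  \<open>G (n + 1) l\<close> is the sum over \<open>j \<le> n\<close> of
  \<open>(n choose j) * fact j * St (j + 1) l * G (n - j) l\<close>, obtained from
  \<open>G_1\<close> by the Leibniz rule.\<close>

lemma G_2:
  assumes l: "0 < l"
  shows "G 2 l = St 2 l * G 0 l + St 1 l * G 1 l"
proof -
  have "- G (Suc 1) l = - (real 1 * St (Suc 1) l) * G 0 l + - G (Suc 0) l * St 1 l"
    by (rule DERIV_eq_on_pos[OF G_1 l G_DERIV[OF l] DERIV_mult[OF St_DERIV[OF l] G_DERIV[OF l]]])
  then show ?thesis
    by (simp add: numeral_2_eq_2 algebra_simps)
qed

lemma G_3:
  assumes l: "0 < l"
  shows "G 3 l = 2 * St 3 l * G 0 l + 2 * St 2 l * G 1 l + St 1 l * G 2 l"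
proof -
  have "- G (Suc 2) l = (- (real 2 * St (Suc 2) l) * G 0 l + - G (Suc 0) l * St 2 l)
      + (- (real 1 * St (Suc 1) l) * G 1 l + - G (Suc 1) l * St 1 l)"
    by (rule DERIV_eq_on_pos[OF G_2 l G_DERIV[OF l] DERIV_add[OF DERIV_mult DERIV_mult]])
      (assumption | rule St_DERIV G_DERIV l)+
  then show ?thesis
    by (simp add: eval_nat_numeral algebra_simps)
qed

lemma G_4:
  assumes l: "0 < l"
  shows "G 4 l = 6 * St 4 l * G 0 l + 6 * St 3 l * G 1 l + 3 * St 2 l * G 2 l + St 1 l * G 3 l"
proof -
  have eq: "G 3 x = 2 * (St 3 x * G 0 x) + 2 * (St 2 x * G 1 x) + St 1 x * G 2 x" if "0 < x" for x
    using G_3[OF that] by simp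
  have "- G (Suc 3) l = 2 * (- (real 3 * St (Suc 3) l) * G 0 l + - G (Suc 0) l * St 3 l)
      + 2 * (- (real 2 * St (Suc 2) l) * G 1 l + - G (Suc 1) l * St 2 l)
      + (- (real 1 * St (Suc 1) l) * G 2 l + - G (Suc 2) l * St 1 l)"
    by (rule DERIV_eq_on_pos[OF eq l G_DERIV[OF l]
          DERIV_add[OF DERIV_add[OF DERIV_cmult[OF DERIV_mult] DERIV_cmult[OF DERIV_mult]] DERIV_mult]])
      (assumption | rule St_DERIV G_DERIV l)+
  then show ?thesis
    by (simp add: eval_nat_numeral algebra_simps)
qed

section \<open>Moments as limits for \<open>l\<close> tending to 0\<close>

definition mom :: "nat \<Rightarrow> real" where
  "mom k = (\<integral>x. x ^ k \<partial>\<nu>)"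

text \<open>The integrands increase as \<open>h i\<close> decreases, so a finite limit forces the
  moment to exist.\<close>

lemma mom_of_limit:
  assumes "(\<lambda>i. G k (h i)) \<longlonglongrightarrow> c"
  shows "integrable \<nu> (\<lambda>x. x ^ k)" "mom k = c"
proof -
  have int: "integrable \<nu> (\<lambda>x. x ^ k * exp (- h i * x))" for i
    by (rule integrable_G) simp
  have mono: "AE x in \<nu>. mono (\<lambda>i. x ^ k * exp (- h i * x))"
    using AE_nu_nonneg
  proof eventually_elim
    case (elim x)
    show ?case
    proof (rule monoI)
      fix i j :: nat assume "i \<le> j"
      then have "h j * x \<le> h i * x"
        using elim by (intro mult_right_mono) (simp_all add: frac_le)
      then show "x ^ k * exp (- h i * x) \<le> x ^ k * exp (- h j * x)"
        using elim by (intro mult_left_mono) simp_all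
    qed
  qed
  have pos: "AE x in \<nu>. 0 \<le> x ^ k * exp (- h i * x)" for i
    using AE_nu_nonneg by eventually_elim simp
  have "(\<lambda>i. x ^ k * exp (- h i * x)) \<longlonglongrightarrow> x ^ k * exp (- 0 * x)" for x
    by (intro tendsto_intros h_tendsto)
  then have lim: "AE x in \<nu>. (\<lambda>i. x ^ k * exp (- h i * x)) \<longlonglongrightarrow> x ^ k"
    by simp
  note * = integral_monotone_convergence_nonneg[OF int mono pos lim assms[unfolded G_def]]
  show "integrable \<nu> (\<lambda>x. x ^ k)" "mom k = c"
    unfolding mom_def by (rule *; measurable)+
qed

text \<open>The converse of \<open>mom_of_limit\<close>. Alternating the two climbs the recursion:
  known lower moments give the limit on the right-hand side, and that limit gives the next
  moment.\<close>

lemma G_tendsto_mom: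
  assumes "integrable \<nu> (\<lambda>x. x ^ k)"
  shows "(\<lambda>i. G k (h i)) \<longlonglongrightarrow> mom k"
  unfolding G_def mom_def
proof (rule integral_dominated_convergence[OF _ _ assms])
  have "(\<lambda>i. x ^ k * exp (- h i * x)) \<longlonglongrightarrow> x ^ k * exp (- 0 * x)" for x
    by (intro tendsto_intros h_tendsto)
  then show "AE x in \<nu>. (\<lambda>i. x ^ k * exp (- h i * x)) \<longlonglongrightarrow> x ^ k"
    by simp
  show "AE x in \<nu>. norm (x ^ k * exp (- h i * x)) \<le> x ^ k" for i
    using AE_nu_nonneg by eventually_elim (simp add: mult_left_le)
qed measurable

lemma St_h_tendsto: "(\<lambda>i. St k (h i)) \<longlonglongrightarrow> St k 0"
  by (rule St_tendsto[OF h_tendsto]) simp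

lemma mom_0: "integrable \<nu> (\<lambda>x. x ^ 0)" "mom 0 = 1"
  by (simp_all add: mom_def nu.prob_space)

lemma mom_1: "integrable \<nu> (\<lambda>x. x ^ 1)" "mom 1 = St 1 0"
proof -
  have "(\<lambda>i. G 1 (h i)) \<longlonglongrightarrow> St 1 0 * mom 0"
    by (subst G_1, simp) (intro tendsto_intros St_h_tendsto G_tendsto_mom mom_0)
  from mom_of_limit[OF this] show "integrable \<nu> (\<lambda>x. x ^ 1)" "mom 1 = St 1 0"
    by (simp_all add: mom_0)
qed

lemma mom_2: "integrable \<nu> (\<lambda>x. x ^ 2)" "mom 2 = St 2 0 + St 1 0 * mom 1"
proof -
  have "(\<lambda>i. G 2 (h i)) \<longlonglongrightarrow> St 2 0 * mom 0 + St 1 0 * mom 1"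
    by (subst G_2, simp) (intro tendsto_intros St_h_tendsto G_tendsto_mom mom_0 mom_1)
  from mom_of_limit[OF this] show "integrable \<nu> (\<lambda>x. x ^ 2)" "mom 2 = St 2 0 + St 1 0 * mom 1"
    by (simp_all add: mom_0)
qed

lemma mom_3: "integrable \<nu> (\<lambda>x. x ^ 3)" "mom 3 = 2 * St 3 0 + 2 * St 2 0 * mom 1 + St 1 0 * mom 2"
proof -
  have "(\<lambda>i. G 3 (h i)) \<longlonglongrightarrow> 2 * St 3 0 * mom 0 + 2 * St 2 0 * mom 1 + St 1 0 * mom 2"
    by (subst G_3, simp) (intro tendsto_intros St_h_tendsto G_tendsto_mom mom_0 mom_1 mom_2)
  from mom_of_limit[OF this]
  show "integrable \<nu> (\<lambda>x. x ^ 3)" "mom 3 = 2 * St 3 0 + 2 * St 2 0 * mom 1 + St 1 0 * mom 2"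
    by (simp_all add: mom_0)
qed

lemma mom_4: "integrable \<nu> (\<lambda>x. x ^ 4)"
  "mom 4 = 6 * St 4 0 + 6 * St 3 0 * mom 1 + 3 * St 2 0 * mom 2 + St 1 0 * mom 3"
proof -
  have "(\<lambda>i. G 4 (h i)) \<longlonglongrightarrow> 6 * St 4 0 * mom 0 + 6 * St 3 0 * mom 1 + 3 * St 2 0 * mom 2 + St 1 0 * mom 3"
    by (subst G_4, simp) (intro tendsto_intros St_h_tendsto G_tendsto_mom mom_0 mom_1 mom_2 mom_3)
  from mom_of_limit[OF this]
  show "integrable \<nu> (\<lambda>x. x ^ 4)"
    "mom 4 = 6 * St 4 0 + 6 * St 3 0 * mom 1 + 3 * St 2 0 * mom 2 + St 1 0 * mom 3"
    by (simp_all add: mom_0)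
qed

end

subsection \<open>The form on quadratic polynomials\<close>

text \<open>The identity plus a multiple of a rotation stretches all vectors equally, so it suffices
  to fix the first argument as the first basis vector and to optimise the second.\<close>

lemma sector_bound_two_dim:
  fixes A B D t C :: real
  defines "\<Delta> \<equiv> A * D - B\<^sup>2"
  assumes A: "0 < A" and \<Delta>: "0 < \<Delta>"
    and sector: "\<And>\<gamma> \<delta>. A * \<gamma> + (B + t) * \<delta> \<le> C * sqrt A * sqrt (A * \<gamma>\<^sup>2 + 2 * B * \<gamma> * \<delta> + D * \<delta>\<^sup>2)"
  shows "sqrt (1 + t\<^sup>2 / \<Delta>) \<le> C"
proof -
  text \<open>\<open>\<gamma> * x + t * y = (\<Delta> / A) * x + t * (y - (B / A) * x)\<close>, where \<open>y - (B / A) * x\<close> is orthogonal to \<open>x\<close> and has square length \<open>\<Delta> / A\<close>.\<close>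
  define \<gamma> where "\<gamma> = (\<Delta> - t * B) / A"
  have A\<gamma>: "A * \<gamma> = \<Delta> - t * B"
    using A by (simp add: \<gamma>_def)
  have pos: "0 < \<Delta> + t\<^sup>2"
    using \<Delta> by (simp add: add_pos_nonneg)
  have "A * (A * \<gamma>\<^sup>2 + 2 * B * \<gamma> * t + D * t\<^sup>2) = (A * \<gamma>)\<^sup>2 + 2 * B * t * (A * \<gamma>) + A * D * t\<^sup>2"
    by (simp add: power2_eq_square algebra_simps)
  also have "\<dots> = \<Delta> * (\<Delta> + t\<^sup>2)"
    unfolding A\<gamma> by (simp add: \<Delta>_def power2_eq_square algebra_simps)
  finally have gg: "sqrt A * sqrt (A * \<gamma>\<^sup>2 + 2 * B * \<gamma> * t + D * t\<^sup>2) = sqrt (\<Delta> * (\<Delta> + t\<^sup>2))"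
    by (simp flip: real_sqrt_mult)
  have "\<Delta> + t\<^sup>2 = A * \<gamma> + (B + t) * t"
    unfolding A\<gamma> by (simp add: power2_eq_square algebra_simps)
  also have "\<dots> \<le> C * sqrt (\<Delta> * (\<Delta> + t\<^sup>2))"
    using sector[of \<gamma> t] unfolding mult.assoc[of C] gg .
  finally have le: "\<Delta> + t\<^sup>2 \<le> C * sqrt (\<Delta> * (\<Delta> + t\<^sup>2))" .
  have "0 < sqrt (\<Delta> * (\<Delta> + t\<^sup>2))"
    using \<Delta> pos by simp
  \<comment> \<open>The sign of \<open>C\<close> follows from \<open>le\<close> and is needed to
    return from squares to \<open>C\<close>.\<close>
  then have C: "0 \<le> C"
    using le pos by (smt (verit) mult_nonneg_nonneg mult_neg_pos)
  have "(\<Delta> + t\<^sup>2)\<^sup>2 \<le> (C * sqrt (\<Delta> * (\<Delta> + t\<^sup>2)))\<^sup>2"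
    using le pos by (intro power_mono) auto
  also have "\<dots> = C\<^sup>2 * \<Delta> * (\<Delta> + t\<^sup>2)"
    using \<Delta> pos by (simp add: power_mult_distrib)
  finally have "\<Delta> + t\<^sup>2 \<le> C\<^sup>2 * \<Delta>"
    using pos by (simp add: power2_eq_square)
  then have "1 + t\<^sup>2 / \<Delta> \<le> C\<^sup>2"
    using \<Delta> by (simp add: field_simps)
  then show ?thesis
    using C by (rule real_le_lsqrt[rotated])
qed

text \<open>\<open>A\<close>, \<open>B\<close>, \<open>D\<close> and \<open>t\<close> are the matrix
  entries found in \<open>form_quadratic\<close>, and \<open>den\<close> is \<open>p ^ 4\<close>
  times the determinant of the symmetric part.\<close>

lemma sector_algebra:
  fixes p q r s :: real
  assumes pos: "0 < p" "0 < q" "0 < r" "0 < s" and pr: "q\<^sup>2 \<le> p * r" and qs: "r\<^sup>2 \<le> q * s"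
  defines "A \<equiv> q / p" and "B \<equiv> 3 * r / p + 2 * q - q\<^sup>2 / p\<^sup>2"
    and "D \<equiv> 12 * s / p + 12 * r + 4 * p * q - 4 * q * r / p\<^sup>2" and "t \<equiv> (q\<^sup>2 - p * r) / p\<^sup>2"
  defines "den \<equiv> 2 * p * q\<^sup>2 * r + 4 * p\<^sup>2 * q ^ 3 + 12 * p\<^sup>2 * q * s - 9 * p\<^sup>2 * r\<^sup>2 - q ^ 4"
  shows "0 < A * D - B\<^sup>2" "t\<^sup>2 / (A * D - B\<^sup>2) = (p * r - q\<^sup>2)\<^sup>2 / den"
proof -
  have eq: "A * D - B\<^sup>2 = den / p ^ 4"
    unfolding A_def B_def D_def den_def using pos(1)
    by (simp add: field_simps power2_eq_square power4_eq_xxxx power3_eq_cube)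
  \<comment> \<open>Two negative terms of \<open>den\<close> must be absorbed:
    \<open>12 * p\<^sup>2 * q * s\<close> dominates the one with factor 9, and
    \<open>2 * p * q\<^sup>2 * r\<close> dominates \<open>q ^ 4\<close>.\<close>
  have "12 * p\<^sup>2 * r\<^sup>2 \<le> 12 * p\<^sup>2 * (q * s)"
    using qs by (intro mult_left_mono) auto
  moreover have "(q\<^sup>2)\<^sup>2 \<le> (p * r)\<^sup>2"
    using pr by (intro power_mono) auto
  then have "q ^ 4 \<le> p\<^sup>2 * r\<^sup>2"
    by (simp add: power_mult_distrib)
  moreover have "q\<^sup>2 * q\<^sup>2 \<le> p * r * q\<^sup>2"
    using pr by (intro mult_right_mono) auto
  then have "q ^ 4 \<le> p * q\<^sup>2 * r"
    by (simp add: mult_ac power2_eq_square power4_eq_xxxx)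
  moreover have "0 < p\<^sup>2 * q ^ 3" "0 < q ^ 4"
    using pos by auto
  ultimately have den: "0 < den"
    unfolding den_def by linarith
  then show "0 < A * D - B\<^sup>2"
    unfolding eq using pos by simp
  have "t\<^sup>2 = (p * r - q\<^sup>2)\<^sup>2 / p ^ 4"
    by (simp add: t_def power_divide power2_commute flip: power_mult)
  then show "t\<^sup>2 / (A * D - B\<^sup>2) = (p * r - q\<^sup>2)\<^sup>2 / den"
    unfolding eq using pos by simp
qed

lemma tempered_quadratic:
  "tempered (2 * (\<bar>\<alpha>\<bar> + \<bar>\<beta>\<bar>)) 0 (\<lambda>x. \<alpha> * x + \<beta> * x\<^sup>2) (\<lambda>x. \<alpha> + 2 * \<beta> * x) (\<lambda>x. 2 * \<beta>)"
  unfolding tempered_def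
proof (intro conjI allI impI)
  show "((\<lambda>x. \<alpha> * x + \<beta> * x\<^sup>2) has_real_derivative \<alpha> + 2 * \<beta> * x) (at x)"
    "((\<lambda>x. \<alpha> + 2 * \<beta> * x) has_real_derivative 2 * \<beta>) (at x)" for x
    by (auto intro!: derivative_eq_intros)
  fix x :: real assume x: "0 \<le> x"
  have "\<bar>\<alpha> * x + \<beta> * x\<^sup>2\<bar> \<le> \<bar>\<alpha>\<bar> * x + \<bar>\<beta>\<bar> * x\<^sup>2"
    using x by (intro order_trans[OF abs_triangle_ineq]) (simp add: abs_mult)
  also have "\<dots> \<le> 2 * \<bar>\<alpha>\<bar> * (1 + x)\<^sup>2 + 2 * \<bar>\<beta>\<bar> * (1 + x)\<^sup>2"
    using x by (intro add_mono mult_mono) (auto simp: power2_eq_square algebra_simps)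
  finally show "\<bar>\<alpha> * x + \<beta> * x\<^sup>2\<bar> \<le> 2 * (\<bar>\<alpha>\<bar> + \<bar>\<beta>\<bar>) * exp (- 0 * x) * (1 + x)\<^sup>2"
    by (simp add: algebra_simps)
  have "\<bar>\<alpha> + 2 * \<beta> * x\<bar> \<le> \<bar>\<alpha>\<bar> + 2 * \<bar>\<beta>\<bar> * x"
    using x by (intro order_trans[OF abs_triangle_ineq]) (simp add: abs_mult)
  also have "\<dots> \<le> 2 * \<bar>\<alpha>\<bar> * (1 + x) + 2 * \<bar>\<beta>\<bar> * (1 + x)"
    using x mult_nonneg_nonneg[OF abs_ge_zero x, of \<alpha>] by (simp add: algebra_simps)
  finally show "\<bar>\<alpha> + 2 * \<beta> * x\<bar> \<le> 2 * (\<bar>\<alpha>\<bar> + \<bar>\<beta>\<bar>) * exp (- 0 * x) * (1 + x)"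
    by (simp add: algebra_simps)
qed auto

section \<open>The matrix of the form and the sector bound\<close>

context cbci_stationary_triple
begin

text \<open>Compensation leaves exactly \<open>\<beta> * y\<^sup>2\<close> of the jump increment, so
  the jump measure enters only through \<open>n2\<close>.\<close>

lemma L_quadratic:
  "L (\<lambda>x. \<alpha> * x + \<beta> * x\<^sup>2) x = \<alpha> - (b * \<alpha> - (2 * a + n2 + 2) * \<beta>) * x - 2 * b * \<beta> * x\<^sup>2"
proof -
  have "(\<integral>y. \<alpha> * (x + y) + \<beta> * (x + y)\<^sup>2 - (\<alpha> * x + \<beta> * x\<^sup>2) - y * (\<alpha> + 2 * \<beta> * x) \<partial>N) = (\<integral>y. \<beta> * y\<^sup>2 \<partial>N)"
    by (rule Bochner_Integration.integral_cong) (simp_all add: power2_eq_square algebra_simps)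
  then show ?thesis
    unfolding L_tempered[OF tempered_quadratic] integral_N_square
    by (simp add: power2_eq_square algebra_simps)
qed

definition p :: real where "p = St 1 0"
definition q :: real where "q = St 2 0"
definition r :: real where "r = St 3 0"
definition s :: real where "s = St 4 0"

lemma pqrs: "0 < p" "0 < q" "0 < r" "0 < s" "q\<^sup>2 \<le> p * r" "r\<^sup>2 \<le> q * s"
  using St_pos[of 0] St_cauchy_schwarz[of 1] St_cauchy_schwarz[of 2]
  by (simp_all add: p_def q_def r_def s_def eval_nat_numeral)

text \<open>The mixed coefficients are written as \<open>B + t\<close> and \<open>B - t\<close>,
  which separates the symmetric from the antisymmetric part.\<close>

lemma form_quadratic:
  "(\<integral>x. (- L (\<lambda>x. \<alpha> * x + \<beta> * x\<^sup>2) x) * (\<gamma> * x + \<delta> * x\<^sup>2) \<partial>\<nu>) =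
    q / p * (\<alpha> * \<gamma>)
    + ((3 * r / p + 2 * q - q\<^sup>2 / p\<^sup>2) + (q\<^sup>2 - p * r) / p\<^sup>2) * (\<alpha> * \<delta>)
    + ((3 * r / p + 2 * q - q\<^sup>2 / p\<^sup>2) - (q\<^sup>2 - p * r) / p\<^sup>2) * (\<beta> * \<gamma>)
    + (12 * s / p + 12 * r + 4 * p * q - 4 * q * r / p\<^sup>2) * (\<beta> * \<delta>)"
proof -
  let ?k = "2 * a + n2 + 2"
  have has_mom: "has_bochner_integral \<nu> (\<lambda>x. x ^ k) (mom k)" if "integrable \<nu> (\<lambda>x. x ^ k)" for k
    using that by (simp add: mom_def has_bochner_integral_iff)
  have "(- L (\<lambda>x. \<alpha> * x + \<beta> * x\<^sup>2) x) * (\<gamma> * x + \<delta> * x\<^sup>2) =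
      - (\<alpha> * \<gamma>) * x ^ 1 + ((b * \<alpha> - ?k * \<beta>) * \<gamma> - \<alpha> * \<delta>) * x ^ 2
      + (2 * b * \<beta> * \<gamma> + (b * \<alpha> - ?k * \<beta>) * \<delta>) * x ^ 3 + 2 * b * \<beta> * \<delta> * x ^ 4" for x
    unfolding L_quadratic by (simp add: power2_eq_square power3_eq_cube power4_eq_xxxx algebra_simps)
  then have "(\<integral>x. (- L (\<lambda>x. \<alpha> * x + \<beta> * x\<^sup>2) x) * (\<gamma> * x + \<delta> * x\<^sup>2) \<partial>\<nu>) =
      - (\<alpha> * \<gamma>) * mom 1 + ((b * \<alpha> - ?k * \<beta>) * \<gamma> - \<alpha> * \<delta>) * mom 2
      + (2 * b * \<beta> * \<gamma> + (b * \<alpha> - ?k * \<beta>) * \<delta>) * mom 3 + 2 * b * \<beta> * \<delta> * mom 4"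
    by (simp only:) (intro has_bochner_integral_integral_eq has_bochner_integral_add has_bochner_integral_mult_right
        has_mom mom_1 mom_2 mom_3 mom_4)
  also have "\<dots> = (b * mom 2 - mom 1) * (\<alpha> * \<gamma>) + (b * mom 3 - mom 2) * (\<alpha> * \<delta>)
      + (2 * b * mom 3 - ?k * mom 2) * (\<beta> * \<gamma>) + (2 * b * mom 4 - ?k * mom 3) * (\<beta> * \<delta>)"
    by (simp add: algebra_simps)
  finally have form: "(\<integral>x. (- L (\<lambda>x. \<alpha> * x + \<beta> * x\<^sup>2) x) * (\<gamma> * x + \<delta> * x\<^sup>2) \<partial>\<nu>) = \<dots>" .
  \<comment> \<open>Here the parameters of the process are eliminated; \<open>a\<close> cancels in
    \<open>2 * a + n2\<close>.\<close>
  have bk: "b = 1 / p" "?k = 2 * q / p\<^sup>2 + 2"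
    by (simp_all add: b_eq n2_def p_def q_def)
  \<comment> \<open>Moments in terms of the cumulants \<open>p\<close>, \<open>q\<close>,
    \<open>2 * r\<close>, \<open>6 * s\<close>.\<close>
  have mom: "mom 1 = p" "mom 2 = q + p\<^sup>2" "mom 3 = 2 * r + 3 * p * q + p ^ 3"
    "mom 4 = 6 * s + 8 * p * r + 3 * q\<^sup>2 + 6 * p\<^sup>2 * q + p ^ 4"
    unfolding mom_4(2) mom_3(2) mom_2(2) mom_1(2) p_def q_def r_def s_def
    by (simp_all add: algebra_simps power2_eq_square power3_eq_cube power4_eq_xxxx)
  have "b * mom 2 - mom 1 = q / p"
    "b * mom 3 - mom 2 = (3 * r / p + 2 * q - q\<^sup>2 / p\<^sup>2) + (q\<^sup>2 - p * r) / p\<^sup>2"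
    "2 * b * mom 3 - ?k * mom 2 = (3 * r / p + 2 * q - q\<^sup>2 / p\<^sup>2) - (q\<^sup>2 - p * r) / p\<^sup>2"
    "2 * b * mom 4 - ?k * mom 3 = 12 * s / p + 12 * r + 4 * p * q - 4 * q * r / p\<^sup>2"
    unfolding bk mom using pqrs(1)
    by (simp_all add: field_simps power2_eq_square power3_eq_cube power4_eq_xxxx)
  then show ?thesis
    unfolding form by simp
qed

lemma integrable_power4: "integrable \<nu> (\<lambda>x. (1 + x) ^ 4)"
proof -
  have "(1 + x) ^ 4 = x ^ 0 + 4 * x ^ 1 + 6 * x ^ 2 + 4 * x ^ 3 + x ^ 4" for x :: real
    by (simp add: power2_eq_square power3_eq_cube power4_eq_xxxx algebra_simps)
  then show ?thesis
    by (simp only:) (intro Bochner_Integration.integrable_add integrable_mult_right mom_0 mom_1 mom_2 mom_3 mom_4)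
qed

text \<open>Every constant admissible on the core remains admissible for quadratics, as limits of
  their truncations. If there is no admissible constant, the infimum is infinite and the bound holds
  as well.\<close>

lemma Sect_bound:
  "ereal (sqrt (1 + (p * r - q\<^sup>2)\<^sup>2 / (2 * p * q\<^sup>2 * r + 4 * p\<^sup>2 * q ^ 3 + 12 * p\<^sup>2 * q * s - 9 * p\<^sup>2 * r\<^sup>2 - q ^ 4)))
    \<le> Sect a b N \<nu>"
  unfolding Sect_def
proof (rule Inf_greatest, clarify)
  fix C
  assume C: "\<forall>f\<in>cbci_core. \<forall>g\<in>cbci_core.
    cbciE a b N \<nu> f g \<le> C * sqrt (cbciE a b N \<nu> f f) * sqrt (cbciE a b N \<nu> g g)"
  let ?P = "\<lambda>\<alpha> \<beta> x. \<alpha> * x + \<beta> * x\<^sup>2 :: real"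
  let ?E = "\<lambda>\<alpha> \<beta> \<gamma> \<delta>. \<integral>x. (- L (?P \<alpha> \<beta>) x) * ?P \<gamma> \<delta> x \<partial>\<nu>"
  have E: "?E \<alpha> \<beta> \<gamma> \<delta> \<le> C * sqrt (?E \<alpha> \<beta> \<alpha> \<beta>) * sqrt (?E \<gamma> \<delta> \<gamma> \<delta>)" for \<alpha> \<beta> \<gamma> \<delta>
  proof (rule LIMSEQ_le)
    note lim = cbciE_trunc_tendsto[OF tempered_quadratic tempered_quadratic integrable_power4]
    show "(\<lambda>i. cbciE a b N \<nu> (trunc (real (Suc i)) (?P \<alpha> \<beta>)) (trunc (real (Suc i)) (?P \<gamma> \<delta>))) \<longlonglongrightarrow> ?E \<alpha> \<beta> \<gamma> \<delta>"
      by (rule lim)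
    show "(\<lambda>i. C * sqrt (cbciE a b N \<nu> (trunc (real (Suc i)) (?P \<alpha> \<beta>)) (trunc (real (Suc i)) (?P \<alpha> \<beta>)))
        * sqrt (cbciE a b N \<nu> (trunc (real (Suc i)) (?P \<gamma> \<delta>)) (trunc (real (Suc i)) (?P \<gamma> \<delta>))))
      \<longlonglongrightarrow> C * sqrt (?E \<alpha> \<beta> \<alpha> \<beta>) * sqrt (?E \<gamma> \<delta> \<gamma> \<delta>)"
      by (intro tendsto_mult tendsto_const tendsto_real_sqrt lim)
    have core: "trunc (real (Suc i)) (?P \<alpha> \<beta>) \<in> cbci_core" for i \<alpha> \<beta>
      by (rule trunc_core[OF tempered_quadratic]) simp
    show "\<exists>n0. \<forall>i\<ge>n0. cbciE a b N \<nu> (trunc (real (Suc i)) (?P \<alpha> \<beta>)) (trunc (real (Suc i)) (?P \<gamma> \<delta>))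
      \<le> C * sqrt (cbciE a b N \<nu> (trunc (real (Suc i)) (?P \<alpha> \<beta>)) (trunc (real (Suc i)) (?P \<alpha> \<beta>)))
        * sqrt (cbciE a b N \<nu> (trunc (real (Suc i)) (?P \<gamma> \<delta>)) (trunc (real (Suc i)) (?P \<gamma> \<delta>)))"
      using C core by blast
  qed
  show "ereal (sqrt (1 + (p * r - q\<^sup>2)\<^sup>2 / (2 * p * q\<^sup>2 * r + 4 * p\<^sup>2 * q ^ 3 + 12 * p\<^sup>2 * q * s - 9 * p\<^sup>2 * r\<^sup>2 - q ^ 4))) \<le> ereal C"
    unfolding ereal_less_eq sector_algebra(2)[OF pqrs, symmetric]
  proof (rule sector_bound_two_dim)
    show "0 < q / p"
      using pqrs by simp
    show "q / p * \<gamma> + (3 * r / p + 2 * q - q\<^sup>2 / p\<^sup>2 + (q\<^sup>2 - p * r) / p\<^sup>2) * \<delta>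
      \<le> C * sqrt (q / p) * sqrt (q / p * \<gamma>\<^sup>2 + 2 * (3 * r / p + 2 * q - q\<^sup>2 / p\<^sup>2) * \<gamma> * \<delta>
        + (12 * s / p + 12 * r + 4 * p * q - 4 * q * r / p\<^sup>2) * \<delta>\<^sup>2)" for \<gamma> \<delta>
    proof -
      have gg: "q / p * (\<gamma> * \<gamma>) + (B + t) * (\<gamma> * \<delta>) + (B - t) * (\<delta> * \<gamma>) + D * (\<delta> * \<delta>)
        = q / p * \<gamma>\<^sup>2 + 2 * B * \<gamma> * \<delta> + D * \<delta>\<^sup>2" for B t D :: real
        by (simp add: power2_eq_square algebra_simps)
      show ?thesis
        using E[of 1 0 \<gamma> \<delta>] unfolding form_quadratic gg by simp
    qed
  qed (rule sector_algebra(1)[OF pqrs])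
qed

end

theorem theorem4p5:
  fixes m M \<nu> :: "real measure" and a b :: real
  assumes m_pos: "on_pos_halfline m"
    and m_nonzero: "emeasure m UNIV \<noteq> 0"
    and m_supp: "Inf (msupport m) > 0"
    and m_finite: "emeasure m UNIV < \<infinity>"
    and a_pos: "a > 0" and b_pos: "b > 0"
    and M_in: "M \<in> calM"
    and triple: "\<And>l. l > 0 \<Longrightarrow>
        (\<integral> u. 1 / (l + u) \<partial>m) = 1 / (a * l + b + (\<integral> u. l / (l + u) \<partial>M))"
    and stat: "cbci_stationary a b (n_of M) \<nu>"
  shows "(Sect a b (n_of M) \<nu>)\<^sup>2 - 1 \<ge>
    ereal ((mbar m (-1) * mbar m (-3) - (mbar m (-2))\<^sup>2)\<^sup>2 /
      (2 * mbar m (-1) * (mbar m (-2))\<^sup>2 * mbar m (-3)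
       + 4 * (mbar m (-1))\<^sup>2 * (mbar m (-2)) ^ 3
       + 12 * (mbar m (-1))\<^sup>2 * mbar m (-2) * mbar m (-4)
       - 9 * (mbar m (-1))\<^sup>2 * (mbar m (-3))\<^sup>2
       - (mbar m (-2)) ^ 4))"
proof -
  interpret cbci_stationary_triple m M a b \<nu>
    by unfold_locales fact+
  have mb: "mbar m (-1) = p" "mbar m (-2) = q" "mbar m (-3) = r" "mbar m (-4) = s"
    using mbar_eq_St[of 1] mbar_eq_St[of 2] mbar_eq_St[of 3] mbar_eq_St[of 4]
    by (simp_all add: p_def q_def r_def s_def)
  define \<rho> where "\<rho> = (p * r - q\<^sup>2)\<^sup>2 /
    (2 * p * q\<^sup>2 * r + 4 * p\<^sup>2 * q ^ 3 + 12 * p\<^sup>2 * q * s - 9 * p\<^sup>2 * r\<^sup>2 - q ^ 4)"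
  have \<rho>: "0 \<le> \<rho>"
    using sector_algebra[OF pqrs] unfolding \<rho>_def by (metis divide_nonneg_pos zero_le_power2)
  have "ereal \<rho> \<le> (Sect a b N \<nu>)\<^sup>2 - 1"
  proof (cases "Sect a b N \<nu>")
    case (real C)
    then have "sqrt (1 + \<rho>) \<le> C"
      using Sect_bound by (simp add: \<rho>_def)
    then have "(sqrt (1 + \<rho>))\<^sup>2 \<le> C\<^sup>2"
      using \<rho> by (intro power_mono) auto
    then show ?thesis
      using \<rho> real by (simp add: one_ereal_def)
  \<comment> \<open>For infinite \<open>Sect\<close> the left side is infinite too; minus infinity
    is excluded by the real lower bound.\<close>
  qed (use Sect_bound in \<open>simp_all add: power2_eq_square\<close>)
  then show ?thesis
    unfolding mb \<rho>_def .
qed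

end
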